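(* Let $M\subset(N^3,g)$ be a $G_X$-invariant surface of constant positive Gauss curvature $K=1/R^2$, locally parametrized by $\psi(u,v)=\phi_v(\gamma(u))$ with $\gamma$ a horizontal lift of the profile curve. Then a loxodrome on $M$ which is not an orbit can be parametrized by $\psi(u,v(u))$ with $$v(u)=\mp\frac{R\cot\vartheta_0}{\sqrt a}\,\operatorname{arcsinh}\left(R\,\frac{\omega_u(u)}{\omega(u)}\right)+b,\qquad a,b\in\mathbb{R},\ a>0,$$ where $\omega(u)=\|X(\gamma(u))\|_g$ and $\vartheta_0$ is the constant angle between the loxodrome and $X$.
   Context: $(N^3,g)$ is a three-dimensional Riemannian manifold, $X$ a Killing vector field on $N$, $G_X$ the one-parameter group of isometries generated by $X$, and $\phi_v$ the local flow of $X$. $N_r\subset N$ is the regular part (the set of points belonging to principal orbits of $G_X$). The quotient $N_r/G_X$ carries the quotient metric $\tilde g$ making $\pi:N_r\to N_r/G_X$ a Riemannian submersion. A $G_X$-invariant surface is the image in $N_r$ of an immersion $f:M\to N$ for which there is an action of $G_X$ on $M$ with $f(xp)=xf(p)$ for all $x\in G_X$, $p\in M$; $M$ carries the induced metric, and its Gauss curvature is that of this metric. Locally it is parametrized by $\psi(u,v)=\phi_v(\gamma(u))$, where $\tilde\gamma:I\to (N_r/G_X,\tilde g)$ ($I$ an open interval) is a curve parametrized by arc length (the profile curve) and $\gamma:I\to N$ is a lift of it. The lift is horizontal if $\gamma'$ is orthogonal to $X$; then the induced metric is $du^2+\omega(u)^2dv^2$. Subscripts $u$ denote derivatives. A loxodrome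 on $M$ is a curve on $M$ making a constant angle $\vartheta_0\in[0,\pi)$ with $X$: parametrized by arc length, $g(\alpha',X)=\omega\cos\vartheta_0$. A loxodrome that is not an orbit has $\vartheta_0\ne0$. *)

theory Defs
  imports "HOL-Analysis.Analysis" "HOL-Algebra.Group_Action"
begin

section \<open>Smooth manifolds\<close>

text \<open>Only used on open sets of finite-dimensional spaces, where this recursion on
  directional derivatives is the usual notion of a function of class C^k.\<close>

primrec Ck_on :: "nat \<Rightarrow> ('a::real_normed_vector \<Rightarrow> 'b::real_normed_vector) \<Rightarrow> 'a set \<Rightarrow> bool" where
  "Ck_on 0 = (\<lambda>f S. continuous_on S f)"
| "Ck_on (Suc k) = (\<lambda>f S. (\<forall>x\<in>S. f differentiable (at x)) \<and>
      (\<forall>v. Ck_on k (\<lambda>x. frechet_derivative f (at x) v) S))"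

definition smooth_on :: "'a::real_normed_vector set \<Rightarrow> ('a \<Rightarrow> 'b::real_normed_vector) \<Rightarrow> bool" where
  "smooth_on S f \<longleftrightarrow> (\<forall>k. Ck_on k f S)"

text \<open>A chart is a pair of an open domain and a coordinate map; the values of the coordinate map
  outside the domain are irrelevant.\<close>

type_synonym ('a, 'd) chart = "'a set \<times> ('a \<Rightarrow> (real, 'd) vec)"

abbreviation dom_chart :: "('a, 'd::finite) chart \<Rightarrow> 'a set" where "dom_chart c \<equiv> fst c"

abbreviation coord :: "('a, 'd::finite) chart \<Rightarrow> 'a \<Rightarrow> real^'d" where "coord c \<equiv> snd c"

definition coord_inv :: "('a, 'd::finite) chart \<Rightarrow> real^'d \<Rightarrow> 'a" where
  "coord_inv c = inv_into (dom_chart c) (coord c)"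

definition is_chart :: "'a topology \<Rightarrow> ('a, 'd::finite) chart \<Rightarrow> bool" where
  "is_chart T c \<longleftrightarrow> openin T (dom_chart c) \<and> open (coord c ` dom_chart c) \<and>
     homeomorphic_map (subtopology T (dom_chart c)) (top_of_set (coord c ` dom_chart c)) (coord c)"

definition smooth_transition :: "('a, 'd::finite) chart \<Rightarrow> ('a, 'd) chart \<Rightarrow> bool" where
  "smooth_transition c d \<longleftrightarrow>
     smooth_on (coord c ` (dom_chart c \<inter> dom_chart d)) (coord d \<circ> coord_inv c)"

definition compatible_charts :: "('a, 'd::finite) chart \<Rightarrow> ('a, 'd) chart \<Rightarrow> bool" where
  "compatible_charts c d \<longleftrightarrow> smooth_transition c d \<and> smooth_transition d c"

text \<open>A smooth manifold of dimension \<open>CARD('d)\<close>, with carrier \<open>topspace T\<close>; the smooth structure is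
  given by the maximal atlas.\<close>

definition smooth_manifold :: "'a topology \<Rightarrow> ('a, 'd::finite) chart set \<Rightarrow> bool" where
  "smooth_manifold T A \<longleftrightarrow>
     Hausdorff_space T \<and> second_countable T \<and>
     (\<forall>c\<in>A. is_chart T c) \<and> (\<Union>c\<in>A. dom_chart c) = topspace T \<and>
     (\<forall>c\<in>A. \<forall>d\<in>A. compatible_charts c d) \<and>
     (\<forall>c. is_chart T c \<and> (\<forall>d\<in>A. compatible_charts c d) \<longrightarrow> c \<in> A)"

text \<open>Smoothness of a map defined on the open subset \<open>S\<close> of the first manifold.\<close>

definition smooth_map_on ::
  "'a topology \<Rightarrow> ('a, 'd::finite) chart set \<Rightarrow> 'a set \<Rightarrow> 'b topology \<Rightarrow> ('b, 'e::finite) chart set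
     \<Rightarrow> ('a \<Rightarrow> 'b) \<Rightarrow> bool" where
  "smooth_map_on T A S T' A' f \<longleftrightarrow>
     openin T S \<and> continuous_map (subtopology T S) T' f \<and>
     (\<forall>c\<in>A. \<forall>d\<in>A'. smooth_on (coord c ` (dom_chart c \<inter> S \<inter> f -` dom_chart d))
        (coord d \<circ> f \<circ> coord_inv c))"

text \<open>The differential of \<open>f\<close> at \<open>p\<close>, in the charts \<open>c\<close> around \<open>p\<close> and \<open>d\<close> around \<open>f p\<close>.\<close>

definition differential ::
  "('a, 'd::finite) chart \<Rightarrow> ('b, 'e::finite) chart \<Rightarrow> ('a \<Rightarrow> 'b) \<Rightarrow> 'a \<Rightarrow> real^'d \<Rightarrow> real^'e" where
  "differential c d f p = frechet_derivative (coord d \<circ> f \<circ> coord_inv c) (at (coord c p))"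

definition smooth_curve ::
  "'a topology \<Rightarrow> ('a, 'd::finite) chart set \<Rightarrow> real set \<Rightarrow> (real \<Rightarrow> 'a) \<Rightarrow> bool" where
  "smooth_curve T A I \<gamma> \<longleftrightarrow> continuous_map (top_of_set I) T \<gamma> \<and>
     (\<forall>c\<in>A. smooth_on (I \<inter> \<gamma> -` dom_chart c) (coord c \<circ> \<gamma>))"

definition open_interval :: "real set \<Rightarrow> bool" where
  "open_interval I \<longleftrightarrow> open I \<and> is_interval I \<and> I \<noteq> {}"

text \<open>\<open>\<Psi>\<close> is a local parametrization on the open set \<open>D\<close>: near each point of \<open>D\<close> it is the inverse of
  a chart of the smooth structure. It need not be injective (for periodic orbits it may wind
  around the surface), so a curve is traced in it by means of continuous coordinate functions.\<close>

definition local_parametrization ::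
  "('a, 'd::finite) chart set \<Rightarrow> (real^'d) set \<Rightarrow> (real^'d \<Rightarrow> 'a) \<Rightarrow> bool" where
  "local_parametrization A D \<Psi> \<longleftrightarrow>
     (\<forall>x\<in>D. \<exists>V. open V \<and> x \<in> V \<and> V \<subseteq> D \<and>
        (\<exists>c\<in>A. dom_chart c = \<Psi> ` V \<and> (\<forall>y\<in>V. coord c (\<Psi> y) = y)))"


section \<open>Tangent vectors and Riemannian metrics\<close>

text \<open>A tangent vector at \<open>p\<close> is represented by the family of its coordinate vectors in the charts
  around \<open>p\<close>, and a metric by its coordinate bilinear forms; both are subject to the
  transformation laws below.\<close>

type_synonym ('a, 'd) tvec = "('a, 'd) chart \<Rightarrow> (real, 'd) vec"

type_synonym ('a, 'd) metric =
  "'a \<Rightarrow> ('a, 'd) chart \<Rightarrow> (real, 'd) vec \<Rightarrow> (real, 'd) vec \<Rightarrow> real"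

definition smooth_vector_field ::
  "('a, 'd::finite) chart set \<Rightarrow> ('a \<Rightarrow> ('a, 'd) tvec) \<Rightarrow> bool" where
  "smooth_vector_field A X \<longleftrightarrow>
     (\<forall>c\<in>A. smooth_on (coord c ` dom_chart c) (\<lambda>x. X (coord_inv c x) c)) \<and>
     (\<forall>c\<in>A. \<forall>d\<in>A. \<forall>p \<in> dom_chart c \<inter> dom_chart d.
        X p d = differential c d (\<lambda>q. q) p (X p c))"

definition riemannian_metric :: "('a, 'd::finite) chart set \<Rightarrow> ('a, 'd) metric \<Rightarrow> bool" where
  "riemannian_metric A g \<longleftrightarrow>
     (\<forall>c\<in>A. \<forall>p\<in>dom_chart c. bilinear (g p c) \<and>
        (\<forall>v w. g p c v w = g p c w v) \<and> (\<forall>v. v \<noteq> 0 \<longrightarrow> 0 < g p c v v)) \<and>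
     (\<forall>c\<in>A. \<forall>v w. smooth_on (coord c ` dom_chart c) (\<lambda>x. g (coord_inv c x) c v w)) \<and>
     (\<forall>c\<in>A. \<forall>d\<in>A. \<forall>p \<in> dom_chart c \<inter> dom_chart d. \<forall>v w.
        g p c v w = g p d (differential c d (\<lambda>q. q) p v) (differential c d (\<lambda>q. q) p w))"

text \<open>By the transformation laws, the choice of the chart is immaterial.\<close>

definition inner_at ::
  "('a, 'd::finite) chart set \<Rightarrow> ('a, 'd) metric \<Rightarrow> 'a \<Rightarrow> ('a, 'd) tvec \<Rightarrow> ('a, 'd) tvec \<Rightarrow> real" where
  "inner_at A g p v w = (let c = (SOME c. c \<in> A \<and> p \<in> dom_chart c) in g p c (v c) (w c))"

definition norm_at ::
  "('a, 'd::finite) chart set \<Rightarrow> ('a, 'd) metric \<Rightarrow> 'a \<Rightarrow> ('a, 'd) tvec \<Rightarrow> real" where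
  "norm_at A g p v = sqrt (inner_at A g p v v)"

definition velocity :: "(real \<Rightarrow> 'a) \<Rightarrow> real \<Rightarrow> ('a, 'd::finite) tvec" where
  "velocity \<gamma> t = (\<lambda>c. vector_derivative (coord c \<circ> \<gamma>) (at t))"

definition pullback_metric ::
  "('b, 'e::finite) chart set \<Rightarrow> ('b, 'e) metric \<Rightarrow> ('a \<Rightarrow> 'b) \<Rightarrow> ('a, 'd::finite) metric" where
  "pullback_metric A' g f p c v w =
     inner_at A' g (f p) (\<lambda>d. differential c d f p v) (\<lambda>d. differential c d f p w)"

definition immersion ::
  "'a topology \<Rightarrow> ('a, 'd::finite) chart set \<Rightarrow> 'b topology \<Rightarrow> ('b, 'e::finite) chart set
     \<Rightarrow> ('a \<Rightarrow> 'b) \<Rightarrow> bool" where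
  "immersion T A T' A' f \<longleftrightarrow> smooth_map_on T A (topspace T) T' A' f \<and>
     (\<forall>c\<in>A. \<forall>d\<in>A'. \<forall>p \<in> dom_chart c. f p \<in> dom_chart d \<longrightarrow> inj (differential c d f p))"

text \<open>Surjective differentials, isometric on the orthogonal complement of their kernels.\<close>

definition riemannian_submersion ::
  "'a topology \<Rightarrow> ('a, 'd::finite) chart set \<Rightarrow> ('a, 'd) metric \<Rightarrow> 'a set
     \<Rightarrow> 'b topology \<Rightarrow> ('b, 'e::finite) chart set \<Rightarrow> ('b, 'e) metric \<Rightarrow> ('a \<Rightarrow> 'b) \<Rightarrow> bool" where
  "riemannian_submersion T A g S T' A' g' f \<longleftrightarrow> smooth_map_on T A S T' A' f \<and>
     (\<forall>c\<in>A. \<forall>d\<in>A'. \<forall>p \<in> dom_chart c \<inter> S. f p \<in> dom_chart d \<longrightarrow>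
        surj (differential c d f p) \<and>
        (\<forall>v w. (\<forall>k. differential c d f p k = 0 \<longrightarrow> g p c v k = 0 \<and> g p c w k = 0) \<longrightarrow>
           g' (f p) d (differential c d f p v) (differential c d f p w) = g p c v w))"

definition isometry :: "'a topology \<Rightarrow> ('a, 'd::finite) chart set \<Rightarrow> ('a, 'd) metric \<Rightarrow> ('a \<Rightarrow> 'a) \<Rightarrow> bool" where
  "isometry T A g f \<longleftrightarrow>
     bij_betw f (topspace T) (topspace T) \<and>
     smooth_map_on T A (topspace T) T A f \<and>
     smooth_map_on T A (topspace T) T A (inv_into (topspace T) f) \<and>
     (\<forall>c\<in>A. \<forall>p\<in>dom_chart c. \<forall>v w. pullback_metric A g f p c v w = g p c v w)"


section \<open>Gauss curvature\<close>

definition partial :: "'d::finite \<Rightarrow> (real^'d \<Rightarrow> real) \<Rightarrow> real^'d \<Rightarrow> real" where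
  "partial i F x = frechet_derivative F (at x) (axis i 1)"

definition gram :: "('a, 'd::finite) metric \<Rightarrow> ('a, 'd) chart \<Rightarrow> real^'d \<Rightarrow> real^'d^'d" where
  "gram g c x = (\<chi> i j. g (coord_inv c x) c (axis i 1) (axis j 1))"

text \<open>\<open>christoffel h k i j\<close> has upper index \<open>k\<close>.\<close>

definition christoffel ::
  "(real^'d \<Rightarrow> real^'d^'d) \<Rightarrow> 'd::finite \<Rightarrow> 'd \<Rightarrow> 'd \<Rightarrow> real^'d \<Rightarrow> real" where
  "christoffel h k i j x =
     (1/2) * (\<Sum>l\<in>UNIV. matrix_inv (h x) $ k $ l *
        (partial i (\<lambda>y. h y $ j $ l) x + partial j (\<lambda>y. h y $ i $ l) x
          - partial l (\<lambda>y. h y $ i $ j) x))"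

text \<open>The \<open>l\<close>-th component of \<open>R(\<partial>\<^sub>i, \<partial>\<^sub>j) \<partial>\<^sub>k\<close>, where
  \<open>R(X, Y) Z = \<nabla>\<^sub>X \<nabla>\<^sub>Y Z - \<nabla>\<^sub>Y \<nabla>\<^sub>X Z - \<nabla>\<^bsub>[X,Y]\<^esub> Z\<close>.\<close>

definition riemann_tensor ::
  "(real^'d \<Rightarrow> real^'d^'d) \<Rightarrow> 'd::finite \<Rightarrow> 'd \<Rightarrow> 'd \<Rightarrow> 'd \<Rightarrow> real^'d \<Rightarrow> real" where
  "riemann_tensor h l k i j x =
     partial i (christoffel h l j k) x - partial j (christoffel h l i k) x
     + (\<Sum>m\<in>UNIV. christoffel h l i m x * christoffel h m j k x
                  - christoffel h l j m x * christoffel h m i k x)"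

text \<open>The Gauss curvature is \<open>g(R(\<partial>\<^sub>1, \<partial>\<^sub>2) \<partial>\<^sub>2, \<partial>\<^sub>1) / det g\<close>.\<close>

definition gauss_curvature :: "('a, 2) metric \<Rightarrow> ('a, 2) chart \<Rightarrow> 'a \<Rightarrow> real" where
  "gauss_curvature g c p =
     (let h = gram g c; x = coord c p in
       (\<Sum>l\<in>UNIV. h x $ l $ 1 * riemann_tensor h l 2 1 2 x) / det (h x))"

definition constant_gauss_curvature ::
  "('a, 2) chart set \<Rightarrow> ('a, 2) metric \<Rightarrow> real \<Rightarrow> bool" where
  "constant_gauss_curvature A g K \<longleftrightarrow>
     (\<forall>c\<in>A. \<forall>p\<in>dom_chart c. gauss_curvature g c p = K)"


section \<open>Killing fields and their one-parameter groups\<close>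

text \<open>The Lie derivative of the metric along \<open>X\<close> vanishes; the left-hand side is its value on
  the coordinate vectors \<open>v\<close> and \<open>w\<close>.\<close>

definition killing_field ::
  "('a, 'd::finite) chart set \<Rightarrow> ('a, 'd) metric \<Rightarrow> ('a \<Rightarrow> ('a, 'd) tvec) \<Rightarrow> bool" where
  "killing_field A g X \<longleftrightarrow> smooth_vector_field A X \<and>
     (\<forall>c\<in>A. \<forall>p\<in>dom_chart c. \<forall>v w.
        (let x = coord c p;
             DX = frechet_derivative (\<lambda>y. X (coord_inv c y) c) (at x)
         in frechet_derivative (\<lambda>y. g (coord_inv c y) c v w) (at x) (X p c)
            + g p c (DX v) w + g p c v (DX w)) = 0)"

text \<open>Isometries are taken to be undefined outside the carrier (membership in \<open>Bij\<close>), so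
  that they are equal as functions as soon as they agree on the manifold.\<close>

definition one_parameter_isometries ::
  "'a topology \<Rightarrow> ('a, 'd::finite) chart set \<Rightarrow> ('a, 'd) metric \<Rightarrow> (real \<Rightarrow> 'a \<Rightarrow> 'a) \<Rightarrow> bool" where
  "one_parameter_isometries T A g \<phi> \<longleftrightarrow>
     (\<forall>t. \<phi> t \<in> Bij (topspace T) \<and> isometry T A g (\<phi> t)) \<and>
     \<phi> 0 = (\<lambda>p\<in>topspace T. p) \<and>
     (\<forall>s t. \<phi> (s + t) = compose (topspace T) (\<phi> s) (\<phi> t))"

definition flow_of ::
  "'a topology \<Rightarrow> ('a, 'd::finite) chart set \<Rightarrow> ('a \<Rightarrow> ('a, 'd) tvec) \<Rightarrow> (real \<Rightarrow> 'a \<Rightarrow> 'a) \<Rightarrow> bool" where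
  "flow_of T A X \<phi> \<longleftrightarrow>
     (\<forall>p\<in>topspace T. \<phi> 0 p = p \<and> continuous_map euclideanreal T (\<lambda>t. \<phi> t p) \<and>
        (\<forall>t. \<forall>c\<in>A. \<phi> t p \<in> dom_chart c \<longrightarrow>
           ((\<lambda>t. coord c (\<phi> t p)) has_vector_derivative X (\<phi> t p) c) (at t)))"

definition GX :: "'a topology \<Rightarrow> (real \<Rightarrow> 'a \<Rightarrow> 'a) \<Rightarrow> ('a \<Rightarrow> 'a) monoid" where
  "GX T \<phi> = (BijGroup (topspace T))\<lparr>carrier := range \<phi>\<rparr>"

abbreviation orbit_GX :: "'a topology \<Rightarrow> (real \<Rightarrow> 'a \<Rightarrow> 'a) \<Rightarrow> 'a \<Rightarrow> 'a set" where
  "orbit_GX T \<phi> p \<equiv> orbit (GX T \<phi>) (\<lambda>x. x) p"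

abbreviation isotropy_GX :: "'a topology \<Rightarrow> (real \<Rightarrow> 'a \<Rightarrow> 'a) \<Rightarrow> 'a \<Rightarrow> ('a \<Rightarrow> 'a) set" where
  "isotropy_GX T \<phi> p \<equiv> stabilizer (GX T \<phi>) (\<lambda>x. x) p"

definition same_orbit_type :: "'a topology \<Rightarrow> (real \<Rightarrow> 'a \<Rightarrow> 'a) \<Rightarrow> 'a \<Rightarrow> 'a \<Rightarrow> bool" where
  "same_orbit_type T \<phi> p q \<longleftrightarrow>
     (\<exists>x\<in>carrier (GX T \<phi>).
        isotropy_GX T \<phi> q =
          x <#\<^bsub>GX T \<phi>\<^esub> isotropy_GX T \<phi> p #>\<^bsub>GX T \<phi>\<^esub> inv\<^bsub>GX T \<phi>\<^esub> x)"

text \<open>An orbit is principal if all orbits through a neighbourhood of one of its points have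
  the same type, i.e. conjugate isotropy groups.\<close>

definition principal_orbit :: "'a topology \<Rightarrow> (real \<Rightarrow> 'a \<Rightarrow> 'a) \<Rightarrow> 'a set \<Rightarrow> bool" where
  "principal_orbit T \<phi> S \<longleftrightarrow>
     (\<exists>p\<in>topspace T. S = orbit_GX T \<phi> p \<and>
        (\<exists>U. openin T U \<and> p \<in> U \<and> (\<forall>q\<in>U. same_orbit_type T \<phi> p q)))"

definition regular_part :: "'a topology \<Rightarrow> (real \<Rightarrow> 'a \<Rightarrow> 'a) \<Rightarrow> 'a set" where
  "regular_part T \<phi> = \<Union>{S. principal_orbit T \<phi> S}"


section \<open>The orbit space, invariant surfaces, lifts and loxodromes\<close>

text \<open>\<open>Q\<close> is the set of regular orbits with the quotient topology (determined by
  the quotient map condition), carrying a smooth structure and the quotient metric.\<close>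

definition riemannian_orbit_space ::
  "'n topology \<Rightarrow> ('n, 3) chart set \<Rightarrow> ('n, 3) metric \<Rightarrow> (real \<Rightarrow> 'n \<Rightarrow> 'n)
     \<Rightarrow> 'n set topology \<Rightarrow> ('n set, 2) chart set \<Rightarrow> ('n set, 2) metric \<Rightarrow> bool" where
  "riemannian_orbit_space T A g \<phi> Q AQ gQ \<longleftrightarrow>
     quotient_map (subtopology T (regular_part T \<phi>)) Q (orbit_GX T \<phi>) \<and>
     smooth_manifold Q AQ \<and> riemannian_metric AQ gQ \<and>
     riemannian_submersion T A g (regular_part T \<phi>) Q AQ gQ (orbit_GX T \<phi>)"

text \<open>The surface is the immersed image of \<open>f\<close>. The action on \<open>M\<close> is only required to be a group
  action; no regularity of it is assumed.\<close>

definition invariant_surface ::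
  "'n topology \<Rightarrow> ('n, 3) chart set \<Rightarrow> (real \<Rightarrow> 'n \<Rightarrow> 'n)
     \<Rightarrow> 'm topology \<Rightarrow> ('m, 2) chart set \<Rightarrow> ('m \<Rightarrow> 'n) \<Rightarrow> bool" where
  "invariant_surface T A \<phi> TM AM f \<longleftrightarrow>
     smooth_manifold TM AM \<and> immersion TM AM T A f \<and> f ` topspace TM \<subseteq> regular_part T \<phi> \<and>
     (\<exists>\<rho>. group_action (GX T \<phi>) (topspace TM) \<rho> \<and>
        (\<forall>x\<in>carrier (GX T \<phi>). \<forall>p\<in>topspace TM. f (\<rho> x p) = x (f p)))"

definition profile_curve ::
  "'q topology \<Rightarrow> ('q, 2) chart set \<Rightarrow> ('q, 2) metric \<Rightarrow> real set \<Rightarrow> (real \<Rightarrow> 'q) \<Rightarrow> bool" where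
  "profile_curve Q AQ gQ I \<gamma> \<longleftrightarrow> open_interval I \<and> smooth_curve Q AQ I \<gamma> \<and>
     (\<forall>u\<in>I. norm_at AQ gQ (\<gamma> u) (velocity \<gamma> u) = 1)"

definition horizontal_lift ::
  "'n topology \<Rightarrow> ('n, 3) chart set \<Rightarrow> ('n, 3) metric \<Rightarrow> ('n \<Rightarrow> ('n, 3) tvec) \<Rightarrow> (real \<Rightarrow> 'n \<Rightarrow> 'n)
     \<Rightarrow> real set \<Rightarrow> (real \<Rightarrow> 'n set) \<Rightarrow> (real \<Rightarrow> 'n) \<Rightarrow> bool" where
  "horizontal_lift T A g X \<phi> I \<beta> \<gamma> \<longleftrightarrow> smooth_curve T A I \<gamma> \<and>
     (\<forall>u\<in>I. \<gamma> u \<in> regular_part T \<phi> \<and> orbit_GX T \<phi> (\<gamma> u) = \<beta> u \<and>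
        inner_at A g (\<gamma> u) (velocity \<gamma> u) (X (\<gamma> u)) = 0)"

text \<open>A curve \<open>\<alpha>\<close> on the surface, parametrized by arc length for the induced metric, whose angle
  with \<open>X\<close> is constantly \<open>\<theta>\<close>.\<close>

definition loxodrome ::
  "('n, 3) chart set \<Rightarrow> ('n, 3) metric \<Rightarrow> ('n \<Rightarrow> ('n, 3) tvec)
     \<Rightarrow> 'm topology \<Rightarrow> ('m, 2) chart set \<Rightarrow> ('m \<Rightarrow> 'n) \<Rightarrow> real \<Rightarrow> real set \<Rightarrow> (real \<Rightarrow> 'm) \<Rightarrow> bool" where
  "loxodrome A g X TM AM f \<theta> L \<alpha> \<longleftrightarrow>
     open_interval L \<and> smooth_curve TM AM L \<alpha> \<and> 0 \<le> \<theta> \<and> \<theta> < pi \<and>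
     (\<forall>s\<in>L. norm_at AM (pullback_metric A g f) (\<alpha> s) (velocity \<alpha> s) = 1 \<and>
        inner_at A g (f (\<alpha> s)) (velocity (f \<circ> \<alpha>) s) (X (f (\<alpha> s)))
          = norm_at A g (f (\<alpha> s)) (X (f (\<alpha> s))) * cos \<theta>)"

definition orbit_arc ::
  "'n topology \<Rightarrow> (real \<Rightarrow> 'n \<Rightarrow> 'n) \<Rightarrow> ('m \<Rightarrow> 'n) \<Rightarrow> real set \<Rightarrow> (real \<Rightarrow> 'm) \<Rightarrow> bool" where
  "orbit_arc T \<phi> f L \<alpha> \<longleftrightarrow> (\<exists>p\<in>topspace T. f ` \<alpha> ` L \<subseteq> orbit_GX T \<phi> p)"

definition smooth_reparametrization :: "real set \<Rightarrow> real set \<Rightarrow> (real \<Rightarrow> real) \<Rightarrow> bool" where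
  "smooth_reparametrization I L \<tau> \<longleftrightarrow>
     bij_betw \<tau> I L \<and> smooth_on I \<tau> \<and> (\<forall>u\<in>I. deriv \<tau> u \<noteq> 0)"

end

theory Submission
  imports Defs
begin

text \<open>
  In the coordinates \<open>(u, v)\<close> the induced metric is \<open>du\<^sup>2 + \<omega>(u)\<^sup>2 dv\<^sup>2\<close>: the isometry \<open>\<phi> v\<close> carries
  \<open>\<gamma>'\<close> and \<open>X\<close> at \<open>\<gamma> u\<close> to the two coordinate vectors, and \<open>\<gamma>'\<close> has unit length because the kernel
  of the differential of the projection to the orbit space is spanned by \<open>X\<close>, which does not
  vanish along an immersed surface. Constant curvature therefore means \<open>\<omega>'' = - \<omega> / R\<^sup>2\<close>, so that
  \<open>a = R\<^sup>2 \<omega>'\<^sup>2 + \<omega>\<^sup>2\<close> is constant. Along a loxodrome parametrized by arc length \<open>\<omega> v' = cos \<theta>\<close> and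
  \<open>u' = \<sigma> sin \<theta>\<close> with a constant sign \<open>\<sigma>\<close>; hence \<open>u\<close> is an affine function of arc length and
  \<open>dv/du = \<sigma> cot \<theta> / \<omega>\<close>, while \<open>arsinh (R \<omega>' / \<omega>)\<close> has derivative \<open>- sqrt a / (R \<omega>)\<close>.
\<close>

section \<open>Functions of class C^k\<close>

lemma Ck_on_cong:
  assumes "open S" "\<And>x. x \<in> S \<Longrightarrow> f x = g x"
  shows "Ck_on k f S = Ck_on k g S"
proof -
  have *: "Ck_on k f S \<Longrightarrow> Ck_on k g S" if "\<And>x. x \<in> S \<Longrightarrow> f x = g x" for f g
    using that
  proof (induction k arbitrary: f g)
    case 0
    then show ?case using continuous_on_cong[of S S f g] by simp
  next
    case (Suc k)
    have diff: "g differentiable (at x)" if "x \<in> S" for x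
      using Suc.prems that \<open>open S\<close> unfolding differentiable_def Ck_on.simps
      by (meson has_derivative_transform_within_open)
    have "frechet_derivative f (at x) v = frechet_derivative g (at x) v" if "x \<in> S" for x v
      using Suc.prems that \<open>open S\<close>
      by (metis Ck_on.simps(2) frechet_derivative_transform_within_open)
    then have "Ck_on k (\<lambda>x. frechet_derivative g (at x) v) S" for v
      using Suc.IH[of "\<lambda>x. frechet_derivative f (at x) v"] Suc.prems(1) by simp
    with diff show ?case by simp
  qed
  show ?thesis using *[of f g] *[of g f] assms(2) by auto
qed

lemma Ck_on_SucD: "Ck_on (Suc k) f S \<Longrightarrow> Ck_on k f S"
proof (induction k arbitrary: f)
  case 0
  then show ?case
    by (auto intro!: continuous_at_imp_continuous_on differentiable_imp_continuous_within)
next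
  case (Suc k)
  then show ?case by (metis Ck_on.simps(2))
qed

lemma Ck_on_const: "Ck_on k (\<lambda>x. c) S"
  by (induction k arbitrary: c) auto

lemma Ck_on_add:
  assumes "open S" "Ck_on k f S" "Ck_on k g S"
  shows "Ck_on k (\<lambda>x. f x + g x) S"
  using assms(2,3)
proof (induction k arbitrary: f g)
  case 0
  then show ?case by (auto intro: continuous_on_add)
next
  case (Suc k)
  have "Ck_on k (\<lambda>x. frechet_derivative (\<lambda>y. f y + g y) (at x) v) S" for v
  proof -
    have "frechet_derivative (\<lambda>y. f y + g y) (at x) v
        = frechet_derivative f (at x) v + frechet_derivative g (at x) v" if "x \<in> S" for x
    proof -
      have "((\<lambda>y. f y + g y) has_derivative
          (\<lambda>v. frechet_derivative f (at x) v + frechet_derivative g (at x) v)) (at x)"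
        using Suc.prems that by (auto intro!: has_derivative_add simp: frechet_derivative_works)
      from frechet_derivative_at[OF this] show ?thesis by metis
    qed
    then show ?thesis
      using Ck_on_cong[OF \<open>open S\<close>, of "\<lambda>x. frechet_derivative (\<lambda>y. f y + g y) (at x) v"
          "\<lambda>x. frechet_derivative f (at x) v + frechet_derivative g (at x) v" k]
        Suc.IH Suc.prems by simp
  qed
  with Suc.prems show ?case by auto
qed

lemma Ck_on_sum:
  assumes "open S" "\<And>i. i \<in> B \<Longrightarrow> Ck_on k (f i) S"
  shows "Ck_on k (\<lambda>x. \<Sum>i\<in>B. f i x) S"
  using assms(2) by (induction B rule: infinite_finite_induct)
    (auto simp: Ck_on_const intro!: Ck_on_add[OF \<open>open S\<close>])

lemma Ck_on_mult:
  fixes f g :: "'a::real_normed_vector \<Rightarrow> real"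
  assumes "open S" "Ck_on k f S" "Ck_on k g S"
  shows "Ck_on k (\<lambda>x. f x * g x) S"
  using assms(2,3)
proof (induction k arbitrary: f g)
  case 0
  then show ?case by (auto intro: continuous_on_mult)
next
  case (Suc k)
  have "Ck_on k (\<lambda>x. frechet_derivative (\<lambda>y. f y * g y) (at x) v) S" for v
  proof -
    have "frechet_derivative (\<lambda>y. f y * g y) (at x) v
        = f x * frechet_derivative g (at x) v + frechet_derivative f (at x) v * g x" if "x \<in> S" for x
    proof -
      have "((\<lambda>y. f y * g y) has_derivative
          (\<lambda>v. f x * frechet_derivative g (at x) v + frechet_derivative f (at x) v * g x)) (at x)"
        using Suc.prems that by (auto intro!: has_derivative_mult simp: frechet_derivative_works)
      from frechet_derivative_at[OF this] show ?thesis by metis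
    qed
    moreover have "Ck_on k (\<lambda>x. f x * frechet_derivative g (at x) v
        + frechet_derivative f (at x) v * g x) S"
      using Suc.prems Ck_on_SucD[of k f S] Ck_on_SucD[of k g S]
      by (intro Ck_on_add[OF \<open>open S\<close>] Suc.IH) auto
    ultimately show ?thesis
      using Ck_on_cong[OF \<open>open S\<close>, of "\<lambda>x. frechet_derivative (\<lambda>y. f y * g y) (at x) v"] by simp
  qed
  with Suc.prems show ?case by auto
qed

lemma Ck_on_inner_left:
  fixes f :: "'a::real_normed_vector \<Rightarrow> 'b::real_inner"
  assumes "open S" "Ck_on k f S"
  shows "Ck_on k (\<lambda>x. f x \<bullet> b) S"
  using assms(2)
proof (induction k arbitrary: f)
  case 0
  then show ?case by (auto intro: continuous_intros)
next
  case (Suc k)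
  have *: "((\<lambda>y. f y \<bullet> b) has_derivative (\<lambda>v. frechet_derivative f (at x) v \<bullet> b)) (at x)"
    if "x \<in> S" for x
    using Suc.prems that by (auto intro!: has_derivative_inner_left simp: frechet_derivative_works)
  have "frechet_derivative (\<lambda>y. f y \<bullet> b) (at x) v = frechet_derivative f (at x) v \<bullet> b"
    if "x \<in> S" for x v
    using frechet_derivative_at[OF *[OF that]] by metis
  then have "Ck_on k (\<lambda>x. frechet_derivative (\<lambda>y. f y \<bullet> b) (at x) v) S" for v
    using Ck_on_cong[OF \<open>open S\<close>, of "\<lambda>x. frechet_derivative (\<lambda>y. f y \<bullet> b) (at x) v"
        "\<lambda>x. frechet_derivative f (at x) v \<bullet> b" k] Suc by simp
  then show ?case using * by (auto simp: differentiable_def)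
qed

lemma Ck_on_compose:
  fixes f :: "'a::real_normed_vector \<Rightarrow> 'b::euclidean_space" and h :: "'b \<Rightarrow> real"
  assumes "open S" "Ck_on k f S" "Ck_on k h U" "f ` S \<subseteq> U"
  shows "Ck_on k (\<lambda>x. h (f x)) S"
  using assms(2,3)
proof (induction k arbitrary: h)
  case 0
  then show ?case
    using \<open>f ` S \<subseteq> U\<close> continuous_on_compose2[of U h S f] by simp
next
  case (Suc k)
  let ?D = "\<lambda>x v. \<Sum>b\<in>Basis. (frechet_derivative f (at x) v \<bullet> b) * frechet_derivative h (at (f x)) b"
  have *: "((\<lambda>y. h (f y)) has_derivative ?D x) (at x)" if "x \<in> S" for x
  proof -
    have df: "f differentiable (at x)" and dh: "h differentiable (at (f x))"
      using Suc.prems that \<open>f ` S \<subseteq> U\<close> by auto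
    have "((\<lambda>y. h (f y)) has_derivative
        (\<lambda>v. frechet_derivative h (at (f x)) (frechet_derivative f (at x) v))) (at x)"
      using df dh unfolding frechet_derivative_works by (rule has_derivative_compose)
    moreover have "frechet_derivative h (at (f x)) w
        = (\<Sum>b\<in>Basis. (w \<bullet> b) * frechet_derivative h (at (f x)) b)" for w
    proof -
      have "frechet_derivative h (at (f x)) (\<Sum>b\<in>Basis. (w \<bullet> b) *\<^sub>R b)
          = (\<Sum>b\<in>Basis. (w \<bullet> b) * frechet_derivative h (at (f x)) b)"
        using linear_frechet_derivative[OF dh] by (simp add: linear_sum linear_scale)
      then show ?thesis unfolding euclidean_representation .
    qed
    then have "(\<lambda>v. frechet_derivative h (at (f x)) (frechet_derivative f (at x) v)) = ?D x"
      by (rule ext)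
    ultimately show ?thesis by (simp only:)
  qed
  have "frechet_derivative (\<lambda>y. h (f y)) (at x) v = ?D x v" if "x \<in> S" for x v
    by (rule fun_cong[OF frechet_derivative_at[OF *[OF that], symmetric]])
  moreover have "Ck_on k (\<lambda>x. ?D x v) S" for v
  proof (intro Ck_on_sum Ck_on_mult Ck_on_inner_left \<open>open S\<close>)
    show "Ck_on k (\<lambda>x. frechet_derivative f (at x) v) S" using Suc.prems by simp
    show "Ck_on k (\<lambda>x. frechet_derivative h (at (f x)) b) S" for b
      using Suc.IH[of "\<lambda>y. frechet_derivative h (at y) b"] Suc.prems Ck_on_SucD[of k f S] by simp
  qed
  ultimately have "Ck_on k (\<lambda>x. frechet_derivative (\<lambda>y. h (f y)) (at x) v) S" for v
    using Ck_on_cong[OF \<open>open S\<close>, of "\<lambda>x. frechet_derivative (\<lambda>y. h (f y)) (at x) v"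
        "\<lambda>x. ?D x v" k] by simp
  then show ?case using * by (auto simp: differentiable_def)
qed

lemma frechet_derivative_real_eq_deriv:
  fixes G :: "real \<Rightarrow> real"
  assumes "G differentiable (at x)"
  shows "frechet_derivative G (at x) 1 = deriv G x"
  using assms
  by (metis (no_types, lifting) DERIV_imp_deriv frechet_derivative_at has_field_derivative_def
      mult.right_neutral real_differentiable_def)

lemma Ck_on_2_real_deriv:
  fixes G :: "real \<Rightarrow> real"
  assumes "open I" "Ck_on 2 G I" "u \<in> I"
  shows "(G has_real_derivative deriv G u) (at u)"
    "(deriv G has_real_derivative deriv (deriv G) u) (at u)"
proof -
  have 1: "G differentiable (at x)" if "x \<in> I" for x
    using assms that by (simp add: numeral_2_eq_2)
  then show "(G has_real_derivative deriv G u) (at u)"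
    using \<open>u \<in> I\<close> DERIV_deriv_iff_real_differentiable by blast
  have "(\<lambda>x. frechet_derivative G (at x) 1) differentiable (at u)"
    using assms by (simp add: numeral_2_eq_2)
  then obtain D where "((\<lambda>x. frechet_derivative G (at x) 1) has_derivative D) (at u)"
    by (auto simp: differentiable_def)
  then have "(deriv G has_derivative D) (at u)"
    by (rule has_derivative_transform_within_open[OF _ \<open>open I\<close> \<open>u \<in> I\<close>])
      (simp add: frechet_derivative_real_eq_deriv 1)
  then show "(deriv G has_real_derivative deriv (deriv G) u) (at u)"
    using DERIV_deriv_iff_real_differentiable differentiable_def by blast
qed

section \<open>Curvature of warped products\<close>

lemma frechet_eq_on_open:
  assumes "open V" "x \<in> V" "\<And>y. y \<in> V \<Longrightarrow> F y = H y" "(H has_derivative D) (at x)"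
  shows "frechet_derivative F (at x) = D"
proof -
  have "(F has_derivative D) (at x)"
    by (rule has_derivative_transform_within_open[OF assms(4,1,2)]) (simp add: assms(3))
  then show ?thesis by (metis frechet_derivative_at)
qed

lemma partial_of_first_coordinate:
  fixes F :: "real^2 \<Rightarrow> real"
  assumes "open V" "x \<in> V" "\<And>y. y \<in> V \<Longrightarrow> F y = H (y $ 1)"
    "(H has_real_derivative D) (at (x $ 1))"
  shows "partial 1 F x = D" "partial 2 F x = 0"
proof -
  have "((\<lambda>y::real^2. H (y $ 1)) has_derivative (\<lambda>v. D * v $ 1)) (at x)"
    by (rule has_derivative_compose[of "\<lambda>y. y $ 1" "\<lambda>v. v $ 1", OF _ assms(4)[unfolded has_field_derivative_def]])
      (auto intro!: bounded_linear_imp_has_derivative bounded_linear_vec_nth)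
  from frechet_eq_on_open[OF assms(1-3) this]
  show "partial 1 F x = D" "partial 2 F x = 0" by (simp_all add: partial_def axis_def)
qed

lemma matrix_inv_diag2:
  fixes A :: "real^2^2"
  assumes "A $ 1 $ 1 = 1" "A $ 1 $ 2 = 0" "A $ 2 $ 1 = 0" "A $ 2 $ 2 = e" "e \<noteq> 0"
  shows "matrix_inv A $ 1 $ 1 = 1" "matrix_inv A $ 1 $ 2 = 0" "matrix_inv A $ 2 $ 1 = 0"
    "matrix_inv A $ 2 $ 2 = 1 / e"
proof -
  have "det A = e" using assms by (simp add: det_2)
  then have "invertible A" using \<open>e \<noteq> 0\<close> by (simp add: invertible_det_nz)
  then have "A ** matrix_inv A = mat 1"
    unfolding invertible_def matrix_inv_def by (rule someI2_ex) simp
  then have "(A ** matrix_inv A) $ i $ j = (if i = j then 1 else 0)" for i j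
    by (simp add: mat_def)
  from this[of 1 1] this[of 1 2] this[of 2 1] this[of 2 2]
  show "matrix_inv A $ 1 $ 1 = 1" "matrix_inv A $ 1 $ 2 = 0" "matrix_inv A $ 2 $ 1 = 0"
    "matrix_inv A $ 2 $ 2 = 1 / e"
    using assms by (auto simp: matrix_matrix_mult_def sum_2 field_simps)
qed

lemma gauss_curvature_warped:
  fixes g :: "('a, 2) metric" and G :: "real \<Rightarrow> real"
  assumes V: "open V" "coord c p \<in> V"
    and I: "\<And>y. y \<in> V \<Longrightarrow> y $ 1 \<in> I"
    and gram: "\<And>y. y \<in> V \<Longrightarrow> gram g c y $ 1 $ 1 = 1 \<and> gram g c y $ 1 $ 2 = 0
        \<and> gram g c y $ 2 $ 1 = 0 \<and> gram g c y $ 2 $ 2 = G (y $ 1)"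
    and pos: "\<And>u. u \<in> I \<Longrightarrow> 0 < G u"
    and d1: "\<And>u. u \<in> I \<Longrightarrow> (G has_real_derivative G' u) (at u)"
    and d2: "\<And>u. u \<in> I \<Longrightarrow> (G' has_real_derivative G'' u) (at u)"
  shows "gauss_curvature g c p
    = - G'' (coord c p $ 1) / (2 * G (coord c p $ 1)) + (G' (coord c p $ 1) / (2 * G (coord c p $ 1)))\<^sup>2"
proof -
  let ?h = "gram g c"
  have const: "partial i F x = 0" if "x \<in> V" "\<And>y. y \<in> V \<Longrightarrow> F y = k" for i :: 2 and F k x
    using partial_of_first_coordinate[OF V(1) that(1), of F "\<lambda>_. k" 0] that(2) exhaust_2[of i]
    by auto
  have p11: "partial i (\<lambda>y. ?h y $ 1 $ 1) x = 0" and p12: "partial i (\<lambda>y. ?h y $ 1 $ 2) x = 0"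
    and p21: "partial i (\<lambda>y. ?h y $ 2 $ 1) x = 0" if "x \<in> V" for i x
    using gram by (auto intro!: const[OF that])
  have p22: "partial 1 (\<lambda>y. ?h y $ 2 $ 2) x = G' (x $ 1)" "partial 2 (\<lambda>y. ?h y $ 2 $ 2) x = 0"
    if "x \<in> V" for x
    using gram partial_of_first_coordinate[OF V(1) that, of "\<lambda>y. ?h y $ 2 $ 2" G, OF _ d1[OF I[OF that]]] by auto
  have inv: "matrix_inv (?h x) $ 1 $ 1 = 1" "matrix_inv (?h x) $ 1 $ 2 = 0"
    "matrix_inv (?h x) $ 2 $ 1 = 0" "matrix_inv (?h x) $ 2 $ 2 = 1 / G (x $ 1)" if "x \<in> V" for x
    using matrix_inv_diag2[of "?h x" "G (x $ 1)"] gram[OF that] pos[OF I[OF that]] by auto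
  note p = p11 p12 p21 p22 inv
  have ch: "christoffel ?h 1 2 2 x = - G' (x $ 1) / 2"
      "christoffel ?h 2 1 2 x = G' (x $ 1) / (2 * G (x $ 1))"
      "christoffel ?h 1 1 2 x = 0" "christoffel ?h 1 1 1 x = 0" "christoffel ?h 2 1 1 x = 0"
      "christoffel ?h 2 2 2 x = 0" "christoffel ?h 1 2 1 x = 0"
    if "x \<in> V" for x
    using that by (simp_all add: christoffel_def sum_2 p)
  let ?x = "coord c p"
  have "((\<lambda>u. - G' u / 2) has_real_derivative - G'' (?x $ 1) / 2) (at (?x $ 1))"
    using d2[OF I[OF V(2)]] by (auto intro!: derivative_eq_intros)
  then have "partial 1 (christoffel ?h 1 2 2) ?x = - G'' (?x $ 1) / 2"
    by (rule partial_of_first_coordinate(1)[OF V, rotated]) (simp add: ch)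
  moreover have "partial 2 (christoffel ?h 1 1 2) ?x = 0"
    by (rule const[OF V(2)]) (simp add: ch)
  ultimately have "riemann_tensor ?h 1 2 1 2 ?x
      = - G'' (?x $ 1) / 2 + G' (?x $ 1) / 2 * (G' (?x $ 1) / (2 * G (?x $ 1)))"
    by (simp add: riemann_tensor_def sum_2 ch V)
  then show ?thesis
    using gram[OF V(2)] pos[OF I[OF V(2)]]
    by (simp add: gauss_curvature_def Let_def sum_2 det_2 field_simps power2_eq_square)
qed

lemma sqrt_of_curvature_equation:
  fixes G :: "real \<Rightarrow> real"
  assumes I: "open I" "u \<in> I" and pos: "\<And>x. x \<in> I \<Longrightarrow> 0 < G x"
    and d1: "\<And>x. x \<in> I \<Longrightarrow> (G has_real_derivative G' x) (at x)"
    and d2: "\<And>x. x \<in> I \<Longrightarrow> (G' has_real_derivative G'' x) (at x)"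
    and K: "- G'' u / (2 * G u) + (G' u / (2 * G u))\<^sup>2 = K"
  shows "((\<lambda>x. sqrt (G x)) has_real_derivative deriv (\<lambda>x. sqrt (G x)) u) (at u)"
    and "(deriv (\<lambda>x. sqrt (G x)) has_real_derivative - K * sqrt (G u)) (at u)"
proof -
  let ?s = "\<lambda>x. sqrt (G x)"
  have s: "(?s has_real_derivative G' x / (2 * ?s x)) (at x)" if "x \<in> I" for x
    using DERIV_chain2[OF DERIV_real_sqrt[OF pos[OF that]] d1[OF that]]
    by (simp add: field_simps)
  then have deriv_s: "deriv ?s x = G' x / (2 * ?s x)" if "x \<in> I" for x
    using that by (blast intro: DERIV_imp_deriv)
  then show "(?s has_real_derivative deriv ?s u) (at u)" using s[OF I(2)] I(2) by simp
  have su: "0 < ?s u" and G: "G u = ?s u * ?s u" using pos[OF I(2)] by auto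
  have "((\<lambda>x. G' x / (2 * ?s x)) has_real_derivative
      (G'' u * (2 * ?s u) - G' u * (2 * (G' u / (2 * ?s u)))) / (2 * ?s u * (2 * ?s u))) (at u)"
    using su by (intro DERIV_divide DERIV_cmult d2 s I(2)) auto
  then have "(deriv ?s has_real_derivative
      (G'' u * (2 * ?s u) - G' u * (2 * (G' u / (2 * ?s u)))) / (2 * ?s u * (2 * ?s u))) (at u)"
    by (rule has_field_derivative_transform_within_open[OF _ I]) (simp add: deriv_s)
  moreover have "(G'' u * (2 * r) - G' u * (2 * (G' u / (2 * r)))) / (2 * r * (2 * r))
      = - (- G'' u / (2 * (r * r)) + (G' u / (2 * (r * r)))\<^sup>2) * r" if "r > 0" for r
    using that by (simp add: field_simps power2_eq_square)
  from this[OF su] have "(G'' u * (2 * ?s u) - G' u * (2 * (G' u / (2 * ?s u)))) / (2 * ?s u * (2 * ?s u))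
      = - K * ?s u"
    unfolding G[symmetric] K .
  ultimately show "(deriv ?s has_real_derivative - K * ?s u) (at u)" by simp
qed

section \<open>Loxodromes of warped products of constant curvature\<close>

lemma sign_constant_of_abs_derivative_constant:
  fixes \<kappa> :: "real \<Rightarrow> real"
  assumes L: "open_interval L" and c: "0 < c"
    and der: "\<And>s. s \<in> L \<Longrightarrow> (\<kappa> has_real_derivative p s) (at s)"
    and p: "\<And>s. s \<in> L \<Longrightarrow> (p s)\<^sup>2 = c\<^sup>2"
  obtains \<epsilon> :: real where "\<epsilon> \<in> {1, -1}" "\<And>s. s \<in> L \<Longrightarrow> p s = \<epsilon> * c"
proof -
  have pc: "p s = c \<or> p s = - c" if "s \<in> L" for s
    using p[OF that] by (simp add: power2_eq_iff)
  have iv: "is_interval L" and oL: "open L" using L by (auto simp: open_interval_def)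
  \<comment> \<open>By Rolle \<open>\<kappa>\<close> is injective, hence monotone.\<close>
  have "inj_on \<kappa> L"
  proof (rule linorder_inj_onI)
    fix x y assume xy: "x < y" "x \<in> L" "y \<in> L"
    then have sub: "\<And>z. x \<le> z \<Longrightarrow> z \<le> y \<Longrightarrow> z \<in> L"
      using iv unfolding is_interval_1 by blast
    obtain z where z: "x < z" "z < y" "\<kappa> y - \<kappa> x = (y - x) * p z"
      using MVT2[OF \<open>x < y\<close>, of \<kappa> p] sub der by blast
    then show "\<kappa> x \<noteq> \<kappa> y" using pc[OF sub, of z] c by auto
  qed auto
  moreover have "continuous_on L \<kappa>"
    by (meson der DERIV_isCont continuous_at_imp_continuous_on)
  ultimately consider "strict_mono_on L \<kappa>" | "strict_antimono_on L \<kappa>"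
    using injective_eq_monotone_map[OF iv] by blast
  then show thesis
  proof cases
    case 1
    have "0 \<le> p s" if "s \<in> L" for s
      using mono_on_imp_deriv_nonneg[OF strict_mono_on_imp_mono_on[OF 1] der[OF that]] oL that
      by (simp add: interior_open)
    then have "p s = 1 * c" if "s \<in> L" for s using pc[OF that] that c by force
    then show thesis using that[of 1] by blast
  next
    case 2
    then have m: "mono_on L (\<lambda>s. - \<kappa> s)"
      by (fastforce simp: monotone_on_def le_less)
    have "p s \<le> 0" if "s \<in> L" for s
      using mono_on_imp_deriv_nonneg[OF m DERIV_minus[OF der[OF that]]] oL that
      by (simp add: interior_open)
    then have "p s = - 1 * c" if "s \<in> L" for s using pc[OF that] that c by force
    then show thesis using that[of "-1"] by blast
  qed
qed

lemma DERIV_zero_constant_on_open: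
  fixes h :: "real \<Rightarrow> real"
  assumes "open S" "connected S" "\<And>x. x \<in> S \<Longrightarrow> (h has_real_derivative 0) (at x)"
  obtains c where "\<And>x. x \<in> S \<Longrightarrow> h x = c"
proof (rule DERIV_zero_connected_constant[OF assms(2,1) finite.emptyI])
  show "continuous_on S h"
    using assms(3) by (meson DERIV_isCont continuous_at_imp_continuous_on)
qed (use assms(3) that in auto)

lemma warping_first_integral:
  fixes \<omega> :: "real \<Rightarrow> real"
  assumes I: "open_interval I" and "R \<noteq> 0"
    and pos: "\<And>u. u \<in> I \<Longrightarrow> 0 < \<omega> u"
    and d1: "\<And>u. u \<in> I \<Longrightarrow> (\<omega> has_real_derivative \<omega>' u) (at u)"
    and d2: "\<And>u. u \<in> I \<Longrightarrow> (\<omega>' has_real_derivative - \<omega> u / R\<^sup>2) (at u)"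
  obtains a where "a > 0" "\<And>u. u \<in> I \<Longrightarrow> R\<^sup>2 * (\<omega>' u)\<^sup>2 + (\<omega> u)\<^sup>2 = a"
proof -
  have "((\<lambda>u. R\<^sup>2 * (\<omega>' u)\<^sup>2 + (\<omega> u)\<^sup>2) has_real_derivative 0) (at u)" if "u \<in> I" for u
    using d1[OF that] d2[OF that] \<open>R \<noteq> 0\<close>
    by (auto intro!: derivative_eq_intros simp: field_simps power2_eq_square)
  moreover have "open I" "connected I" "I \<noteq> {}"
    using I by (auto simp: open_interval_def is_interval_connected_1)
  ultimately obtain a where a: "\<And>u. u \<in> I \<Longrightarrow> R\<^sup>2 * (\<omega>' u)\<^sup>2 + (\<omega> u)\<^sup>2 = a"
    using DERIV_zero_constant_on_open by blast
  obtain u where "u \<in> I" using \<open>I \<noteq> {}\<close> by blast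
  then have "0 < a"
    unfolding a[OF \<open>u \<in> I\<close>, symmetric] using pos[of u] by (intro add_nonneg_pos) auto
  with a that show thesis by blast
qed

lemma DERIV_arsinh_log_derivative:
  fixes \<omega> :: "real \<Rightarrow> real"
  assumes "R \<noteq> 0" "0 < \<omega> u" "0 < a" "R\<^sup>2 * (\<omega>' u)\<^sup>2 + (\<omega> u)\<^sup>2 = a"
    and d1: "(\<omega> has_real_derivative \<omega>' u) (at u)"
    and d2: "(\<omega>' has_real_derivative - \<omega> u / R\<^sup>2) (at u)"
  shows "((\<lambda>u. arsinh (R * (\<omega>' u / \<omega> u))) has_real_derivative - sqrt a / (R * \<omega> u)) (at u)"
proof -
  let ?x = "R * (\<omega>' u / \<omega> u)"
  have "?x\<^sup>2 + 1 = a / (\<omega> u)\<^sup>2"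
    using assms(2,4) by (auto simp: field_simps power2_eq_square)
  then have s: "sqrt (?x\<^sup>2 + 1) = sqrt a / \<omega> u"
    using assms(2) by (simp add: real_sqrt_divide)
  have "((\<lambda>u. R * (\<omega>' u / \<omega> u)) has_real_derivative
      R * ((- \<omega> u / R\<^sup>2 * \<omega> u - \<omega>' u * \<omega>' u) / (\<omega> u * \<omega> u))) (at u)"
    using assms(2) by (intro DERIV_cmult DERIV_divide d1 d2) auto
  moreover have "R * ((- \<omega> u / R\<^sup>2 * \<omega> u - \<omega>' u * \<omega>' u) / (\<omega> u * \<omega> u)) = - a / (R * (\<omega> u)\<^sup>2)"
    using assms(1,2) by (simp add: assms(4)[symmetric] field_simps power2_eq_square)
  ultimately have "((\<lambda>u. arsinh (R * (\<omega>' u / \<omega> u))) has_real_derivative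
      1 / sqrt (?x\<^sup>2 + 1) * (- a / (R * (\<omega> u)\<^sup>2))) (at u)"
    by (intro DERIV_chain2[OF arsinh_real_has_field_derivative]) auto
  moreover have "1 / sqrt (?x\<^sup>2 + 1) * (- a / (R * (\<omega> u)\<^sup>2)) = - sqrt a / (R * \<omega> u)"
  proof -
    have "a = sqrt a * sqrt a" using assms(3) by simp
    then show ?thesis
      unfolding s using assms(1-3) by (simp add: field_simps power2_eq_square)
  qed
  ultimately show ?thesis by simp
qed

lemma smooth_on_affine: "smooth_on S (\<lambda>u::real. m * u + c)"
proof -
  have 1: "((\<lambda>u. m * u + c) has_derivative (\<lambda>v. m * v)) (at x)" for x
    by (auto intro!: derivative_eq_intros)
  have 2: "frechet_derivative (\<lambda>u. m * u + c) (at x) v = m * v" for x v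
    by (metis 1 frechet_derivative_at)
  have "Ck_on k (\<lambda>u. m * u + c) S" for k
    using 1 by (cases k) (auto simp: 2 Ck_on_const differentiable_def intro!: continuous_intros)
  then show ?thesis by (simp add: smooth_on_def)
qed

lemma loxodrome_in_warped_product:
  fixes \<omega> \<omega>' \<kappa>\<^sub>1 \<kappa>\<^sub>2 p q :: "real \<Rightarrow> real"
  assumes I: "open_interval I" and L: "open_interval L" and R: "R \<noteq> 0"
    and pos: "\<And>u. u \<in> I \<Longrightarrow> 0 < \<omega> u"
    and d1: "\<And>u. u \<in> I \<Longrightarrow> (\<omega> has_real_derivative \<omega>' u) (at u)"
    and d2: "\<And>u. u \<in> I \<Longrightarrow> (\<omega>' has_real_derivative - \<omega> u / R\<^sup>2) (at u)"
    and in_I: "\<And>s. s \<in> L \<Longrightarrow> \<kappa>\<^sub>1 s \<in> I"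
    and dp: "\<And>s. s \<in> L \<Longrightarrow> (\<kappa>\<^sub>1 has_real_derivative p s) (at s)"
    and dq: "\<And>s. s \<in> L \<Longrightarrow> (\<kappa>\<^sub>2 has_real_derivative q s) (at s)"
    and arc: "\<And>s. s \<in> L \<Longrightarrow> (p s)\<^sup>2 + (\<omega> (\<kappa>\<^sub>1 s) * q s)\<^sup>2 = 1"
    and angle: "\<And>s. s \<in> L \<Longrightarrow> \<omega> (\<kappa>\<^sub>1 s) * q s = cos \<theta>"
    and sin: "0 < sin \<theta>"
  shows "\<exists>\<sigma>\<in>{1, -1}. \<exists>a>0. \<exists>b I' \<tau>. open_interval I' \<and> I' \<subseteq> I \<and> smooth_reparametrization I' L \<tau> \<and>
    (\<forall>u\<in>I'. \<kappa>\<^sub>1 (\<tau> u) = u \<and>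
       \<kappa>\<^sub>2 (\<tau> u) = - \<sigma> * (R * cot \<theta> / sqrt a) * arsinh (R * (\<omega>' u / \<omega> u)) + b)"
proof -
  have "(p s)\<^sup>2 = (sin \<theta>)\<^sup>2" if "s \<in> L" for s
    using arc[OF that] angle[OF that] by (simp add: sin_squared_eq)
  from sign_constant_of_abs_derivative_constant[OF L sin dp this]
  obtain \<sigma> :: real where \<sigma>: "\<sigma> \<in> {1, -1}" and p: "\<And>s. s \<in> L \<Longrightarrow> p s = \<sigma> * sin \<theta>"
    by blast
  have \<sigma>\<sigma>: "\<sigma> * \<sigma> = 1" "\<sigma> \<noteq> 0" using \<sigma> by auto
  obtain a where a: "a > 0" "\<And>u. u \<in> I \<Longrightarrow> R\<^sup>2 * (\<omega>' u)\<^sup>2 + (\<omega> u)\<^sup>2 = a"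
    using warping_first_integral[OF I R pos d1 d2] by metis
  have oL: "open L" "connected L" "L \<noteq> {}"
    using L by (auto simp: open_interval_def is_interval_connected_1)
  have const: "\<exists>b. \<forall>s\<in>L. h s = b"
    if "\<And>s. s \<in> L \<Longrightarrow> (h has_real_derivative 0) (at s)" for h :: "real \<Rightarrow> real"
    using DERIV_zero_constant_on_open[OF oL(1,2) that] by blast
  have "\<exists>e. \<forall>s\<in>L. \<kappa>\<^sub>1 s - \<sigma> * sin \<theta> * s = e"
    by (rule const) (use dp p in \<open>auto intro!: derivative_eq_intros\<close>)
  then obtain e where e: "\<And>s. s \<in> L \<Longrightarrow> \<kappa>\<^sub>1 s = \<sigma> * sin \<theta> * s + e"
    by (metis add.commute diff_add_cancel)
  let ?A = "\<lambda>u. arsinh (R * (\<omega>' u / \<omega> u))"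
  have "\<exists>b. \<forall>s\<in>L. \<kappa>\<^sub>2 s - - \<sigma> * (R * cot \<theta> / sqrt a) * ?A (\<kappa>\<^sub>1 s) = b"
  proof (rule const)
    fix s assume s: "s \<in> L"
    note u = in_I[OF s]
    have "((\<lambda>s. ?A (\<kappa>\<^sub>1 s)) has_real_derivative - sqrt a / (R * \<omega> (\<kappa>\<^sub>1 s)) * p s) (at s)"
      using DERIV_chain2[OF DERIV_arsinh_log_derivative[where \<omega> = \<omega> and \<omega>' = \<omega>',
            OF R pos[OF u] a(1) a(2)[OF u] d1[OF u] d2[OF u]] dp[OF s]] .
    from DERIV_diff[OF dq[OF s] DERIV_cmult[OF this, of "- \<sigma> * (R * cot \<theta> / sqrt a)"]]
    have "((\<lambda>s. \<kappa>\<^sub>2 s - - \<sigma> * (R * cot \<theta> / sqrt a) * ?A (\<kappa>\<^sub>1 s)) has_real_derivative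
        q s - - \<sigma> * (R * cot \<theta> / sqrt a) * (- sqrt a / (R * \<omega> (\<kappa>\<^sub>1 s)) * p s)) (at s)" .
    moreover have "q s = cos \<theta> / \<omega> (\<kappa>\<^sub>1 s)"
      using angle[OF s] pos[OF u] by (simp add: field_simps)
    then have "q s - - \<sigma> * (R * cot \<theta> / sqrt a) * (- sqrt a / (R * \<omega> (\<kappa>\<^sub>1 s)) * p s) = 0"
      using R a(1) pos[OF u] sin \<sigma> by (auto simp: p[OF s] cot_def)
    ultimately show "((\<lambda>s. \<kappa>\<^sub>2 s - - \<sigma> * (R * cot \<theta> / sqrt a) * ?A (\<kappa>\<^sub>1 s)) has_real_derivative 0) (at s)"
      by simp
  qed
  then obtain b where b: "\<And>s. s \<in> L \<Longrightarrow> \<kappa>\<^sub>2 s = - \<sigma> * (R * cot \<theta> / sqrt a) * ?A (\<kappa>\<^sub>1 s) + b"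
    by (metis add.commute diff_add_cancel)
  define m where "m = \<sigma> / sin \<theta>"
  define \<tau> where "\<tau> = (\<lambda>u. m * u + - m * e)"
  have \<tau>\<kappa>: "\<tau> (\<kappa>\<^sub>1 s) = s" if "s \<in> L" for s
    using sin \<sigma>\<sigma> by (simp add: \<tau>_def m_def e[OF that] field_simps)
  have img: "\<kappa>\<^sub>1 ` L = \<tau> -` L"
  proof (intro equalityI subsetI)
    fix u assume "u \<in> \<tau> -` L"
    then have "\<kappa>\<^sub>1 (\<tau> u) = \<sigma> * sin \<theta> * \<tau> u + e" using e by simp
    also have "\<dots> = u" using sin \<sigma> by (auto simp: \<tau>_def m_def field_simps)
    finally show "u \<in> \<kappa>\<^sub>1 ` L" using \<open>u \<in> \<tau> -` L\<close> by (metis imageI vimageD)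
  qed (use \<tau>\<kappa> in auto)
  have "open (\<kappa>\<^sub>1 ` L)"
    unfolding img \<tau>_def by (intro open_vimage oL) (auto intro!: continuous_intros)
  moreover have "connected (\<kappa>\<^sub>1 ` L)"
    by (rule connected_continuous_image[OF _ oL(2)])
      (use dp in \<open>auto intro!: continuous_at_imp_continuous_on DERIV_isCont\<close>)
  ultimately have "open_interval (\<kappa>\<^sub>1 ` L)"
    using oL(3) by (simp add: open_interval_def is_interval_connected_1)
  moreover have "smooth_reparametrization (\<kappa>\<^sub>1 ` L) L \<tau>"
  proof -
    have "bij_betw \<tau> (\<kappa>\<^sub>1 ` L) L"
      by (rule bij_betw_byWitness[where f' = \<kappa>\<^sub>1]) (use \<tau>\<kappa> in auto)
    moreover have "(\<tau> has_real_derivative m) (at u)" for u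
      unfolding \<tau>_def by (auto intro!: derivative_eq_intros)
    then have "deriv \<tau> u = m" for u by (rule DERIV_imp_deriv)
    ultimately show ?thesis
      using sin \<sigma>\<sigma> smooth_on_affine[of _ m "- m * e"]
      by (simp add: smooth_reparametrization_def m_def \<tau>_def)
  qed
  moreover have "\<kappa>\<^sub>1 (\<tau> u) = u \<and> \<kappa>\<^sub>2 (\<tau> u) = - \<sigma> * (R * cot \<theta> / sqrt a) * ?A u + b"
    if "u \<in> \<kappa>\<^sub>1 ` L" for u
    using that \<tau>\<kappa> b by auto
  ultimately show ?thesis
    using \<sigma> a(1) in_I by (intro bexI[of _ \<sigma>] exI[of _ a] conjI exI[of _ b] exI[of _ "\<kappa>\<^sub>1 ` L"] exI[of _ \<tau>])
      auto
qed

section \<open>Charts and differentials\<close>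

definition chart_at :: "('a, 'd::finite) chart set \<Rightarrow> 'a \<Rightarrow> ('a, 'd) chart" where
  "chart_at A p = (SOME c. c \<in> A \<and> p \<in> dom_chart c)"

lemma chart_at:
  assumes "smooth_manifold T A" "p \<in> topspace T"
  shows "chart_at A p \<in> A" "p \<in> dom_chart (chart_at A p)"
proof -
  have "\<exists>c. c \<in> A \<and> p \<in> dom_chart c"
    using assms unfolding smooth_manifold_def by blast
  from someI_ex[OF this] show "chart_at A p \<in> A" "p \<in> dom_chart (chart_at A p)"
    by (auto simp: chart_at_def)
qed

lemma inner_at_chart_at:
  "inner_at A g p v w = g p (chart_at A p) (v (chart_at A p)) (w (chart_at A p))"
  by (simp add: inner_at_def chart_at_def Let_def)

lemma smooth_manifold_is_chart: "smooth_manifold T A \<Longrightarrow> c \<in> A \<Longrightarrow> is_chart T c"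
  by (simp add: smooth_manifold_def)

lemma dom_chart_subset: "is_chart T c \<Longrightarrow> dom_chart c \<subseteq> topspace T"
  by (auto simp: is_chart_def dest: openin_subset)

lemma coord_inv_coord:
  assumes "is_chart T c" "p \<in> dom_chart c"
  shows "coord_inv c (coord c p) = p"
proof -
  have "inj_on (coord c) (topspace (subtopology T (dom_chart c)))"
    using assms(1) homeomorphic_imp_injective_map unfolding is_chart_def by blast
  then have "inj_on (coord c) (dom_chart c)"
    using dom_chart_subset[OF assms(1)] by (simp add: inf_absorb2 topspace_subtopology)
  then show ?thesis using assms(2) by (simp add: coord_inv_def)
qed

lemma open_preimage_of_curve:
  assumes "continuous_map (top_of_set I) T \<eta>" "open I" "openin T U"
  shows "open (I \<inter> \<eta> -` U)"
proof -
  have "openin (top_of_set I) {t \<in> I. \<eta> t \<in> U}"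
    using assms(1,3) by (simp add: continuous_map_def)
  moreover have "{t \<in> I. \<eta> t \<in> U} = I \<inter> \<eta> -` U" by auto
  ultimately show ?thesis using assms(2) by (simp add: openin_open_eq)
qed

lemma smooth_curve_has_velocity:
  assumes "smooth_curve T A I \<eta>" "c \<in> A" "t \<in> I" "\<eta> t \<in> dom_chart c"
  shows "((coord c \<circ> \<eta>) has_vector_derivative velocity \<eta> t c) (at t)"
proof -
  have "Ck_on (Suc 0) (coord c \<circ> \<eta>) (I \<inter> \<eta> -` dom_chart c)"
    using assms(1,2) unfolding smooth_curve_def smooth_on_def by blast
  then have "(coord c \<circ> \<eta>) differentiable (at t)"
    using assms(3,4) by simp
  then show ?thesis by (simp add: velocity_def vector_derivative_works)
qed

lemma smooth_map_on_differentiable: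
  assumes "smooth_map_on T A S T' A' h" "c \<in> A" "d \<in> A'"
    and "p \<in> dom_chart c" "p \<in> S" "h p \<in> dom_chart d"
  shows "(coord d \<circ> h \<circ> coord_inv c) differentiable (at (coord c p))"
proof -
  have "Ck_on (Suc 0) (coord d \<circ> h \<circ> coord_inv c) (coord c ` (dom_chart c \<inter> S \<inter> h -` dom_chart d))"
    using assms(1-3) unfolding smooth_map_on_def smooth_on_def by blast
  then show ?thesis using assms(4-6) by auto
qed

lemma linear_differential:
  assumes "smooth_map_on T A S T' A' h" "c \<in> A" "d \<in> A'"
    and "p \<in> dom_chart c" "p \<in> S" "h p \<in> dom_chart d"
  shows "linear (differential c d h p)"
  unfolding differential_def
  by (rule linear_frechet_derivative[OF smooth_map_on_differentiable[OF assms]])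

lemma differential_along_curve:
  assumes h: "smooth_map_on T A S T' A' h" "c \<in> A" "d \<in> A'" "is_chart T c"
    and p: "\<eta> t \<in> S" "h (\<eta> t) \<in> dom_chart d"
    and W: "open W" "t \<in> W" "\<And>s. s \<in> W \<Longrightarrow> \<eta> s \<in> dom_chart c"
    and w: "((coord c \<circ> \<eta>) has_vector_derivative w) (at t)"
  shows "((coord d \<circ> h \<circ> \<eta>) has_vector_derivative differential c d h (\<eta> t) w) (at t)"
proof -
  let ?H = "coord d \<circ> h \<circ> coord_inv c"
  have "?H differentiable (at (coord c (\<eta> t)))"
    by (rule smooth_map_on_differentiable[OF h(1-3) W(3)[OF W(2)] p])
  then have H: "(?H has_derivative differential c d h (\<eta> t)) (at ((coord c \<circ> \<eta>) t))"
    by (simp add: differential_def frechet_derivative_works)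
  have "((\<lambda>s. ?H ((coord c \<circ> \<eta>) s)) has_derivative
      (\<lambda>r. differential c d h (\<eta> t) (r *\<^sub>R w))) (at t)"
    by (rule has_derivative_compose[OF w[unfolded has_vector_derivative_def] H])
  then have "((\<lambda>s. ?H ((coord c \<circ> \<eta>) s)) has_vector_derivative differential c d h (\<eta> t) w) (at t)"
    using has_derivative_linear[OF H] by (simp add: has_vector_derivative_def linear_scale)
  then show ?thesis
    by (rule has_vector_derivative_transform_within_open[OF _ W(1,2)])
      (simp add: coord_inv_coord[OF h(4) W(3)])
qed

lemma inner_at_smooth_vector_field:
  assumes "smooth_manifold T A" "riemannian_metric A g" "smooth_vector_field A X"
    and c: "c \<in> A" "p \<in> dom_chart c"
  shows "inner_at A g p (X p) (X p) = g p c (X p c) (X p c)"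
proof -
  have "p \<in> topspace T" using dom_chart_subset smooth_manifold_is_chart assms by blast
  note d = chart_at[OF assms(1) this]
  have "X p (chart_at A p) = differential c (chart_at A p) (\<lambda>q. q) p (X p c)"
    using assms(3) c d unfolding smooth_vector_field_def by blast
  moreover have "g p c (X p c) (X p c) = g p (chart_at A p)
      (differential c (chart_at A p) (\<lambda>q. q) p (X p c)) (differential c (chart_at A p) (\<lambda>q. q) p (X p c))"
    using assms(2) c d unfolding riemannian_metric_def by blast
  ultimately show ?thesis by (simp add: inner_at_chart_at)
qed

lemma Ck_on_norm_square_along_curve:
  fixes A :: "('a, 'd::finite) chart set"
  assumes M: "smooth_manifold T A" "riemannian_metric A g" "smooth_vector_field A X"
    and \<gamma>: "smooth_curve T A I \<gamma>" "open I" "u \<in> I"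
  obtains W where "open W" "u \<in> W"
    "Ck_on k (\<lambda>t. inner_at A g (\<gamma> t) (X (\<gamma> t)) (X (\<gamma> t))) W"
proof -
  let ?c = "chart_at A (\<gamma> u)"
  have "\<gamma> u \<in> topspace T" using \<gamma> by (auto simp: smooth_curve_def continuous_map_def)
  note c = chart_at[OF M(1) this]
  have ch: "is_chart T ?c" by (rule smooth_manifold_is_chart[OF M(1) c(1)])
  define W where "W = I \<inter> \<gamma> -` dom_chart ?c"
  have W: "open W" "u \<in> W"
    using open_preimage_of_curve[of I T \<gamma> "dom_chart ?c"] \<gamma> ch c(2)
    by (auto simp: W_def smooth_curve_def is_chart_def)
  let ?U = "coord ?c ` dom_chart ?c"
  have U: "open ?U" using ch by (simp add: is_chart_def)
  let ?Z = "\<lambda>x. X (coord_inv ?c x) ?c"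
  define H where "H = (\<lambda>x. \<Sum>(b, b')\<in>Basis \<times> Basis.
    (?Z x \<bullet> b) * (?Z x \<bullet> b') * g (coord_inv ?c x) ?c b b')"
  have "Ck_on k ?Z ?U"
    using M(3) c(1) by (simp add: smooth_vector_field_def smooth_on_def)
  moreover have "Ck_on k (\<lambda>x. g (coord_inv ?c x) ?c v w) ?U" for v w
    using M(2) c(1) by (simp add: riemannian_metric_def smooth_on_def)
  ultimately have "Ck_on k H ?U"
    unfolding H_def split_beta by (intro Ck_on_sum Ck_on_mult Ck_on_inner_left U)
  moreover have "Ck_on k (coord ?c \<circ> \<gamma>) W"
    using \<gamma>(1) c(1) by (simp add: smooth_curve_def smooth_on_def W_def)
  ultimately have "Ck_on k (\<lambda>t. H ((coord ?c \<circ> \<gamma>) t)) W"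
    using Ck_on_compose[OF W(1), of k "coord ?c \<circ> \<gamma>" H ?U] by (auto simp: W_def)
  moreover have "inner_at A g (\<gamma> t) (X (\<gamma> t)) (X (\<gamma> t)) = H ((coord ?c \<circ> \<gamma>) t)" if "t \<in> W" for t
  proof -
    have t: "\<gamma> t \<in> dom_chart ?c" using that by (simp add: W_def)
    let ?v = "X (\<gamma> t) ?c"
    have bl: "bilinear (g (\<gamma> t) ?c)" using M(2) c(1) t by (simp add: riemannian_metric_def)
    have "inner_at A g (\<gamma> t) (X (\<gamma> t)) (X (\<gamma> t)) = g (\<gamma> t) ?c ?v ?v"
      by (rule inner_at_smooth_vector_field[OF M c(1) t])
    also have "\<dots> = g (\<gamma> t) ?c (\<Sum>b\<in>Basis. (?v \<bullet> b) *\<^sub>R b) (\<Sum>b\<in>Basis. (?v \<bullet> b) *\<^sub>R b)"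
      by (simp add: euclidean_representation)
    also have "\<dots> = (\<Sum>(b, b')\<in>Basis \<times> Basis. g (\<gamma> t) ?c ((?v \<bullet> b) *\<^sub>R b) ((?v \<bullet> b') *\<^sub>R b'))"
      by (rule bilinear_sum[OF bl])
    also have "\<dots> = (\<Sum>(b, b')\<in>Basis \<times> Basis. (?v \<bullet> b) * (?v \<bullet> b') * g (\<gamma> t) ?c b b')"
      by (simp add: bilinear_lmul[OF bl] bilinear_rmul[OF bl] mult_ac)
    also have "\<dots> = H ((coord ?c \<circ> \<gamma>) t)"
      by (simp add: H_def coord_inv_coord[OF ch t])
    finally show ?thesis .
  qed
  ultimately have "Ck_on k (\<lambda>t. inner_at A g (\<gamma> t) (X (\<gamma> t)) (X (\<gamma> t))) W"
    using Ck_on_cong[OF W(1), of "\<lambda>t. inner_at A g (\<gamma> t) (X (\<gamma> t)) (X (\<gamma> t))"] by simp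
  with W that show thesis by blast
qed

lemma kernel_of_surjection_3_2:
  fixes D :: "real^3 \<Rightarrow> real^2"
  assumes "linear D" "surj D" "D x = 0" "x \<noteq> 0" "D k = 0"
  obtains r where "k = r *\<^sub>R x"
proof (cases "k \<in> span {x}")
  case True
  then show thesis using that by (auto simp: span_singleton)
next
  case False
  then have ind: "independent {k, x}" "k \<noteq> x"
    using \<open>x \<noteq> 0\<close> span_base[of x "{x}"] by (auto simp: independent_insert)
  from maximal_independent_subset_extend[OF subset_UNIV ind(1)]
  obtain B where B: "{k, x} \<subseteq> B" "independent B" "UNIV \<subseteq> span B" by metis
  have "card B = 3"
    using basis_card_eq_dim[OF subset_UNIV B(3,2)] by simp
  then have "finite B" using card.infinite by fastforce
  then have c1: "card (B - {k, x}) = 1"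
    using B(1) ind(2) \<open>card B = 3\<close> by (simp add: card_Diff_subset)
  have "span (D ` B) = UNIV"
    using B(3) \<open>surj D\<close> linear_span_image[OF assms(1)] by (metis top.extremum_uniqueI)
  moreover have "D ` B \<subseteq> insert 0 (D ` (B - {k, x}))" using assms by auto
  ultimately have "UNIV \<subseteq> span (D ` (B - {k, x}))"
    using span_mono by (metis span_insert_0)
  then have "dim (UNIV :: (real^2) set) \<le> card (D ` (B - {k, x}))"
    using \<open>finite B\<close> by (intro dim_le_card) auto
  also have "\<dots> \<le> 1" using c1 card_image_le[of "B - {k, x}" D] \<open>finite B\<close> by simp
  finally show thesis by simp
qed

section \<open>Flows of isometries\<close>

lemma flow_in_topspace:
  "one_parameter_isometries T A g \<phi> \<Longrightarrow> p \<in> topspace T \<Longrightarrow> \<phi> t p \<in> topspace T"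
  unfolding one_parameter_isometries_def Bij_def bij_betw_def by auto

lemma flow_add:
  "one_parameter_isometries T A g \<phi> \<Longrightarrow> p \<in> topspace T \<Longrightarrow> \<phi> s (\<phi> t p) = \<phi> (s + t) p"
  by (simp add: one_parameter_isometries_def compose_def)

lemma orbit_GX_eq: "orbit_GX T \<phi> p = range (\<lambda>t. \<phi> t p)"
  by (auto simp: orbit_def GX_def)

lemma orbit_GX_flow:
  assumes "one_parameter_isometries T A g \<phi>" "p \<in> topspace T"
  shows "orbit_GX T \<phi> (\<phi> t p) = orbit_GX T \<phi> p"
proof -
  have "\<phi> s p \<in> range (\<lambda>s. \<phi> (s + t) p)" for s
    by (rule range_eqI[of _ _ "s - t"]) simp
  then show ?thesis unfolding orbit_GX_eq flow_add[OF assms] by auto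
qed

lemma differential_along_flow:
  assumes M: "smooth_manifold T A" and fl: "flow_of T A X \<phi>"
    and h: "smooth_map_on T A S T' A' h"
    and c: "c \<in> A" "p \<in> dom_chart c" and p: "p \<in> S" and d: "d \<in> A'" "h p \<in> dom_chart d"
  shows "((\<lambda>t. coord d (h (\<phi> t p))) has_vector_derivative differential c d h p (X p c)) (at 0)"
proof -
  have ch: "is_chart T c" by (rule smooth_manifold_is_chart[OF M c(1)])
  then have "p \<in> topspace T" using dom_chart_subset c by blast
  then have f0: "\<phi> 0 p = p" and cont: "continuous_map euclideanreal T (\<lambda>t. \<phi> t p)"
    and der: "\<phi> t p \<in> dom_chart c \<Longrightarrow>
      ((\<lambda>t. coord c (\<phi> t p)) has_vector_derivative X (\<phi> t p) c) (at t)" for t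
    using fl c(1) by (auto simp: flow_of_def)
  have "open (UNIV \<inter> (\<lambda>t. \<phi> t p) -` dom_chart c)"
    by (rule open_preimage_of_curve[of _ T]) (use cont ch in \<open>auto simp: is_chart_def\<close>)
  then have "((coord d \<circ> h \<circ> (\<lambda>t. \<phi> t p)) has_vector_derivative
      differential c d h ((\<lambda>t. \<phi> t p) 0) (X p c)) (at 0)"
    by (rule differential_along_curve[OF h c(1) d(1) ch, rotated 2])
      (use der[of 0] in \<open>auto simp: f0 p c d o_def\<close>)
  then show ?thesis by (simp add: o_def f0)
qed

lemma differential_flow_generator:
  assumes M: "smooth_manifold T A" and iso: "one_parameter_isometries T A g \<phi>" and fl: "flow_of T A X \<phi>"
    and c: "c \<in> A" "p \<in> dom_chart c" and d: "d \<in> A" "\<phi> v p \<in> dom_chart d"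
  shows "differential c d (\<phi> v) p (X p c) = X (\<phi> v p) d"
proof -
  have p: "p \<in> topspace T" using dom_chart_subset smooth_manifold_is_chart[OF M] c by blast
  note q = flow_in_topspace[OF iso p, of v]
  have "smooth_map_on T A (topspace T) T A (\<phi> v)"
    using iso by (simp add: one_parameter_isometries_def isometry_def)
  from differential_along_flow[OF M fl this c p d]
  have "((\<lambda>t. coord d (\<phi> t (\<phi> v p))) has_vector_derivative
      differential c d (\<phi> v) p (X p c)) (at 0)"
    by (simp add: flow_add[OF iso p] add.commute)
  moreover have "((\<lambda>t. coord d (\<phi> t (\<phi> v p))) has_vector_derivative X (\<phi> v p) d) (at 0)"
    using fl q d unfolding flow_of_def by metis
  ultimately show ?thesis by (rule vector_derivative_unique_at)
qed

lemma metric_differential_isometry: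
  assumes "isometry T A g h" "c \<in> A" "p \<in> dom_chart c"
  shows "g (h p) (chart_at A (h p)) (differential c (chart_at A (h p)) h p v)
    (differential c (chart_at A (h p)) h p w) = g p c v w"
  using assms unfolding isometry_def pullback_metric_def inner_at_chart_at by blast

section \<open>Invariant surfaces in natural coordinates\<close>

lemma vec2_expand: "(x :: real^2) = x $ 1 *\<^sub>R axis 1 1 + x $ 2 *\<^sub>R axis 2 1"
  by (simp add: vec_eq_iff forall_2 axis_def)

lemma vector_2_eq: "vector [x $ 1, x $ 2] = (x :: real^2)"
  by (simp add: vec_eq_iff forall_2)

locale invariant_patch =
  fixes TN :: "'n topology" and AN :: "('n, 3) chart set" and g :: "('n, 3) metric"
    and X :: "'n \<Rightarrow> ('n, 3) tvec" and \<phi> :: "real \<Rightarrow> 'n \<Rightarrow> 'n"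
    and Q :: "'n set topology" and AQ :: "('n set, 2) chart set" and gQ :: "('n set, 2) metric"
    and TM :: "'m topology" and AM :: "('m, 2) chart set" and f :: "'m \<Rightarrow> 'n"
    and I J :: "real set" and \<beta> :: "real \<Rightarrow> 'n set" and \<gamma> :: "real \<Rightarrow> 'n" and \<Psi> :: "real^2 \<Rightarrow> 'm"
  assumes N: "smooth_manifold TN AN" and g: "riemannian_metric AN g"
    and X: "smooth_vector_field AN X" and iso: "one_parameter_isometries TN AN g \<phi>"
    and fl: "flow_of TN AN X \<phi>" and Q: "riemannian_orbit_space TN AN g \<phi> Q AQ gQ"
    and M: "smooth_manifold TM AM" and f: "immersion TM AM TN AN f"
    and \<beta>: "profile_curve Q AQ gQ I \<beta>" and \<gamma>: "horizontal_lift TN AN g X \<phi> I \<beta> \<gamma>"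
    and J: "open_interval J" and \<Psi>: "local_parametrization AM {x. x $ 1 \<in> I \<and> x $ 2 \<in> J} \<Psi>"
    and f\<Psi>: "\<And>u v. u \<in> I \<Longrightarrow> v \<in> J \<Longrightarrow> f (\<Psi> (vector [u, v])) = \<phi> v (\<gamma> u)"
begin

abbreviation cN :: "'n \<Rightarrow> ('n, 3) chart" where "cN \<equiv> chart_at AN"

definition G :: "real \<Rightarrow> real" where "G u = inner_at AN g (\<gamma> u) (X (\<gamma> u)) (X (\<gamma> u))"

definition patch :: "('m, 2) chart \<Rightarrow> (real^2) set \<Rightarrow> bool" where
  "patch c V \<longleftrightarrow> c \<in> AM \<and> open V \<and> V \<subseteq> {x. x $ 1 \<in> I \<and> x $ 2 \<in> J} \<and>
     dom_chart c = \<Psi> ` V \<and> (\<forall>y\<in>V. coord c (\<Psi> y) = y)"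

lemma patch_exists:
  assumes "x $ 1 \<in> I" "x $ 2 \<in> J"
  obtains c V where "patch c V" "x \<in> V"
proof -
  obtain V c where "open V" "x \<in> V" "V \<subseteq> {x. x $ 1 \<in> I \<and> x $ 2 \<in> J}" "c \<in> AM"
    "dom_chart c = \<Psi> ` V" "\<forall>y\<in>V. coord c (\<Psi> y) = y"
    using \<Psi>[unfolded local_parametrization_def, rule_format, of x] assms by auto
  then show thesis using that[of c V] by (simp add: patch_def)
qed

lemma domains_open: "open I" "open J" "J \<noteq> {}" "open_interval I"
  using \<beta> J by (auto simp: profile_curve_def open_interval_def)

lemma \<gamma>_smooth: "smooth_curve TN AN I \<gamma>"
  using \<gamma> by (simp add: horizontal_lift_def)

lemma \<gamma>_topspace: "u \<in> I \<Longrightarrow> \<gamma> u \<in> topspace TN"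
  using \<gamma>_smooth by (auto simp: smooth_curve_def continuous_map_def)

lemma cN_chart:
  assumes "p \<in> topspace TN"
  shows "cN p \<in> AN" "p \<in> dom_chart (cN p)" "is_chart TN (cN p)"
  using chart_at[OF N assms] smooth_manifold_is_chart[OF N] by auto

lemma flow_smooth: "smooth_map_on TN AN (topspace TN) TN AN (\<phi> v)" "isometry TN AN g (\<phi> v)"
  using iso by (auto simp: one_parameter_isometries_def isometry_def)

lemma f_smooth: "smooth_map_on TM AM (topspace TM) TN AN f"
  using f by (simp add: immersion_def)

lemma patchD:
  assumes "patch c V" "x \<in> V"
  shows "c \<in> AM" "is_chart TM c" "open V" "x $ 1 \<in> I" "x $ 2 \<in> J" "\<Psi> x \<in> dom_chart c"
    "\<Psi> x \<in> topspace TM" "coord c (\<Psi> x) = x" "coord_inv c x = \<Psi> x" "f (\<Psi> x) = \<phi> (x $ 2) (\<gamma> (x $ 1))"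
    "f (\<Psi> x) \<in> topspace TN"
proof -
  show c: "c \<in> AM" "open V" "x $ 1 \<in> I" "x $ 2 \<in> J" "\<Psi> x \<in> dom_chart c" "coord c (\<Psi> x) = x"
    using assms by (auto simp: patch_def)
  show ch: "is_chart TM c" by (rule smooth_manifold_is_chart[OF M c(1)])
  show "\<Psi> x \<in> topspace TM" using dom_chart_subset[OF ch] c(5) by blast
  show "coord_inv c x = \<Psi> x" using coord_inv_coord[OF ch c(5)] c(6) by simp
  show eq: "f (\<Psi> x) = \<phi> (x $ 2) (\<gamma> (x $ 1))" using f\<Psi>[OF c(3,4)] by (simp add: vector_2_eq)
  show "f (\<Psi> x) \<in> topspace TN"
    unfolding eq by (rule flow_in_topspace[OF iso \<gamma>_topspace[OF c(3)]])
qed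

lemma differential_along_coordinate_line:
  assumes p: "patch c V" "x \<in> V" and d: "d \<in> AN" "f (\<Psi> x) \<in> dom_chart d"
  shows "((\<lambda>t. coord d (f (\<Psi> (x + t *\<^sub>R w)))) has_vector_derivative differential c d f (\<Psi> x) w) (at 0)"
proof -
  note pD = patchD[OF p]
  let ?l = "\<lambda>t. x + t *\<^sub>R w"
  have W: "open (?l -` V)"
    by (intro open_vimage pD) (auto intro!: continuous_intros)
  have "((coord c \<circ> (\<lambda>t. \<Psi> (?l t))) has_vector_derivative w) (at 0)"
  proof (rule has_vector_derivative_transform_within_open[OF _ W])
    show "(?l has_vector_derivative w) (at 0)" by (auto intro!: derivative_eq_intros)
  qed (use p patchD(8)[OF p(1)] in auto)
  then have "((coord d \<circ> f \<circ> (\<lambda>t. \<Psi> (?l t))) has_vector_derivative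
      differential c d f (\<Psi> (?l 0)) w) (at 0)"
    by (intro differential_along_curve[OF f_smooth pD(1) d(1) pD(2) _ _ W])
      (use p d pD patchD(6)[OF p(1)] in auto)
  then show ?thesis by (simp add: o_def)
qed

lemma differential_coordinate_vectors:
  assumes p: "patch c V" "x \<in> V" and d: "d \<in> AN" "f (\<Psi> x) \<in> dom_chart d"
  defines "u \<equiv> x $ 1" and "v \<equiv> x $ 2"
  shows "differential c d f (\<Psi> x) (axis 1 1)
      = differential (cN (\<gamma> u)) d (\<phi> v) (\<gamma> u) (velocity \<gamma> u (cN (\<gamma> u)))"
    and "differential c d f (\<Psi> x) (axis 2 1) = X (f (\<Psi> x)) d"
    and "X (f (\<Psi> x)) d = differential (cN (\<gamma> u)) d (\<phi> v) (\<gamma> u) (X (\<gamma> u) (cN (\<gamma> u)))"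
proof -
  note pD = patchD[OF p]
  have u: "u \<in> I" and v: "v \<in> J" using pD by (auto simp: u_def v_def)
  note c = cN_chart[OF \<gamma>_topspace[OF u]]
  have q: "f (\<Psi> x) = \<phi> v (\<gamma> u)" using pD by (simp add: u_def v_def)
  show "X (f (\<Psi> x)) d = differential (cN (\<gamma> u)) d (\<phi> v) (\<gamma> u) (X (\<gamma> u) (cN (\<gamma> u)))"
    using differential_flow_generator[OF N iso fl c(1,2) d(1)] d(2) by (simp add: q)
  have line: "x + t *\<^sub>R axis 1 1 = vector [u + t, v]" "x + t *\<^sub>R axis 2 1 = vector [u, v + t]" for t
    by (simp_all add: vec_eq_iff forall_2 axis_def u_def v_def)
  let ?J = "(\<lambda>t. v + t) -` J"
  have J0: "open ?J" "0 \<in> ?J"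
    using v by (auto intro!: open_vimage domains_open continuous_intros)
  have fl_q: "((\<lambda>t. coord d (\<phi> t (f (\<Psi> x)))) has_vector_derivative X (f (\<Psi> x)) d) (at 0)"
    using fl pD(11) d unfolding flow_of_def by metis
  have "((\<lambda>t. coord d (f (\<Psi> (x + t *\<^sub>R axis 2 1)))) has_vector_derivative X (f (\<Psi> x)) d) (at 0)"
    by (rule has_vector_derivative_transform_within_open[OF fl_q J0])
      (use u f\<Psi> in \<open>auto simp: line q flow_add[OF iso \<gamma>_topspace] add.commute\<close>)
  with differential_along_coordinate_line[OF p d]
  show "differential c d f (\<Psi> x) (axis 2 1) = X (f (\<Psi> x)) d"
    by (rule vector_derivative_unique_at)
  let ?I = "(\<lambda>t. u + t) -` (I \<inter> \<gamma> -` dom_chart (cN (\<gamma> u)))"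
  have "open (I \<inter> \<gamma> -` dom_chart (cN (\<gamma> u)))"
    using \<gamma>_smooth c(3) domains_open(1) by (intro open_preimage_of_curve) (auto simp: smooth_curve_def is_chart_def)
  then have "open ?I" by (rule open_vimage) (auto intro!: continuous_intros)
  moreover have "0 \<in> ?I" using u c by simp
  ultimately have I0: "open ?I" "0 \<in> ?I" .
  have "((\<lambda>t. u + t) has_vector_derivative 1) (at 0)" by (auto intro!: derivative_eq_intros)
  from vector_diff_chain_at[OF this, of "coord (cN (\<gamma> u)) \<circ> \<gamma>" "velocity \<gamma> u (cN (\<gamma> u))"]
  have vel: "((coord (cN (\<gamma> u)) \<circ> (\<lambda>t. \<gamma> (u + t))) has_vector_derivative
      velocity \<gamma> u (cN (\<gamma> u))) (at 0)"
    using smooth_curve_has_velocity[OF \<gamma>_smooth c(1) u c(2)] by (simp add: o_def)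
  have "((coord d \<circ> \<phi> v \<circ> (\<lambda>t. \<gamma> (u + t))) has_vector_derivative
      differential (cN (\<gamma> u)) d (\<phi> v) (\<gamma> (u + 0)) (velocity \<gamma> u (cN (\<gamma> u)))) (at 0)"
    by (intro differential_along_curve[OF flow_smooth(1) c(1) d(1) c(3) _ _ I0 _ vel])
      (use u \<gamma>_topspace d q in auto)
  then have "((\<lambda>t. coord d (\<phi> v (\<gamma> (u + t)))) has_vector_derivative
      differential (cN (\<gamma> u)) d (\<phi> v) (\<gamma> u) (velocity \<gamma> u (cN (\<gamma> u)))) (at 0)"
    by (simp add: o_def)
  then have "((\<lambda>t. coord d (f (\<Psi> (x + t *\<^sub>R axis 1 1)))) has_vector_derivative
      differential (cN (\<gamma> u)) d (\<phi> v) (\<gamma> u) (velocity \<gamma> u (cN (\<gamma> u)))) (at 0)"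
    by (rule has_vector_derivative_transform_within_open[OF _ I0])
      (use v f\<Psi> in \<open>auto simp: line\<close>)
  with differential_along_coordinate_line[OF p d]
  show "differential c d f (\<Psi> x) (axis 1 1)
      = differential (cN (\<gamma> u)) d (\<phi> v) (\<gamma> u) (velocity \<gamma> u (cN (\<gamma> u)))"
    by (rule vector_derivative_unique_at)
qed

lemma generator_nonzero:
  assumes u: "u \<in> I"
  shows "X (\<gamma> u) (cN (\<gamma> u)) \<noteq> 0"
proof
  assume 0: "X (\<gamma> u) (cN (\<gamma> u)) = 0"
  obtain v where v: "v \<in> J" using domains_open by blast
  obtain c V where p: "patch c V" "vector [u, v] \<in> V"
    using patch_exists[of "vector [u, v]"] u v by auto
  let ?x = "vector [u, v] :: real^2"
  note pD = patchD[OF p]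
  note d = cN_chart[OF pD(11)]
  note c = cN_chart[OF \<gamma>_topspace[OF u]]
  have "linear (differential (cN (\<gamma> u)) (cN (f (\<Psi> ?x))) (\<phi> v) (\<gamma> u))"
    by (rule linear_differential[OF flow_smooth(1) c(1) d(1) c(2) \<gamma>_topspace[OF u]])
      (use d(2) pD(10) in simp)
  then have "differential c (cN (f (\<Psi> ?x))) f (\<Psi> ?x) (axis 2 1) = 0"
    using differential_coordinate_vectors(2,3)[OF p d(1,2)] by (simp add: 0 linear_0)
  moreover have lin: "linear (differential c (cN (f (\<Psi> ?x))) f (\<Psi> ?x))"
    by (rule linear_differential[OF f_smooth pD(1) d(1) pD(6,7) d(2)])
  moreover have "inj (differential c (cN (f (\<Psi> ?x))) f (\<Psi> ?x))"
    using f pD(1,6) d(1,2) unfolding immersion_def by blast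
  ultimately have "axis 2 (1::real) = (0 :: real^2)" by (metis injD linear_0)
  then show False by (simp add: axis_eq_0_iff)
qed

lemma G_pos: "u \<in> I \<Longrightarrow> 0 < G u"
  using generator_nonzero[of u] cN_chart[OF \<gamma>_topspace[of u]] g
  unfolding G_def inner_at_chart_at riemannian_metric_def by blast

lemma horizontal_lift_unit_speed:
  assumes u: "u \<in> I"
  shows "g (\<gamma> u) (cN (\<gamma> u)) (velocity \<gamma> u (cN (\<gamma> u))) (velocity \<gamma> u (cN (\<gamma> u))) = 1"
proof -
  let ?c = "cN (\<gamma> u)" and ?d = "chart_at AQ (\<beta> u)" and ?\<pi> = "orbit_GX TN \<phi>"
  let ?D = "differential ?c ?d ?\<pi> (\<gamma> u)" and ?w = "velocity \<gamma> u ?c"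
  note c = cN_chart[OF \<gamma>_topspace[OF u]]
  have Q': "smooth_manifold Q AQ" "riemannian_submersion TN AN g (regular_part TN \<phi>) Q AQ gQ ?\<pi>"
    using Q by (auto simp: riemannian_orbit_space_def)
  then have \<pi>: "smooth_map_on TN AN (regular_part TN \<phi>) Q AQ ?\<pi>"
    by (simp add: riemannian_submersion_def)
  have \<gamma>u: "\<gamma> u' \<in> regular_part TN \<phi>" "?\<pi> (\<gamma> u') = \<beta> u'" if "u' \<in> I" for u'
    using \<gamma> that by (auto simp: horizontal_lift_def)
  have sc: "smooth_curve Q AQ I \<beta>" using \<beta> by (simp add: profile_curve_def)
  then have "\<beta> u \<in> topspace Q" using u by (auto simp: smooth_curve_def continuous_map_def)
  note d = chart_at[OF Q'(1) this]
  have d': "?\<pi> (\<gamma> u) \<in> dom_chart ?d" using d \<gamma>u u by simp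
  have lin: "linear ?D" by (rule linear_differential[OF \<pi> c(1) d(1) c(2) \<gamma>u(1)[OF u] d'])
  have sub: "surj ?D" "\<And>v w. (\<And>k. ?D k = 0 \<Longrightarrow> g (\<gamma> u) ?c v k = 0 \<and> g (\<gamma> u) ?c w k = 0) \<Longrightarrow>
      gQ (?\<pi> (\<gamma> u)) ?d (?D v) (?D w) = g (\<gamma> u) ?c v w"
    using Q'(2) c d(1) d' \<gamma>u(1)[OF u] unfolding riemannian_submersion_def by blast+
  have "((\<lambda>t. coord ?d (?\<pi> (\<phi> t (\<gamma> u)))) has_vector_derivative ?D (X (\<gamma> u) ?c)) (at 0)"
    by (rule differential_along_flow[OF N fl \<pi> c(1,2) \<gamma>u(1)[OF u] d(1) d'])
  then have "((\<lambda>t. coord ?d (?\<pi> (\<gamma> u))) has_vector_derivative ?D (X (\<gamma> u) ?c)) (at 0)"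
    by (simp add: orbit_GX_flow[OF iso \<gamma>_topspace[OF u]])
  then have X0: "?D (X (\<gamma> u) ?c) = 0"
    using vector_derivative_unique_at has_vector_derivative_const by blast
  have bl: "bilinear (g (\<gamma> u) ?c)" using g c(1,2) by (simp add: riemannian_metric_def)
  have "inner_at AN g (\<gamma> u) (velocity \<gamma> u) (X (\<gamma> u)) = 0"
    using \<gamma> u by (simp add: horizontal_lift_def)
  then have orth: "g (\<gamma> u) ?c ?w (X (\<gamma> u) ?c) = 0" by (simp add: inner_at_chart_at)
  have "g (\<gamma> u) ?c ?w k = 0" if "?D k = 0" for k
    using kernel_of_surjection_3_2[OF lin sub(1) X0 generator_nonzero[OF u] that]
    by (metis bilinear_rmul[OF bl] orth scaleR_zero_right)
  then have "g (\<gamma> u) ?c ?w ?w = gQ (\<beta> u) ?d (?D ?w) (?D ?w)"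
    using sub(2)[of ?w ?w] \<gamma>u(2)[OF u] by simp
  also have "?D ?w = velocity \<beta> u ?d"
  proof -
    let ?W = "I \<inter> \<gamma> -` dom_chart ?c"
    have W: "open ?W" "u \<in> ?W"
      using \<gamma>_smooth c domains_open(1) u
      by (auto intro!: open_preimage_of_curve simp: smooth_curve_def is_chart_def)
    have "((coord ?d \<circ> ?\<pi> \<circ> \<gamma>) has_vector_derivative ?D ?w) (at u)"
      by (rule differential_along_curve[OF \<pi> c(1) d(1) c(3) \<gamma>u(1)[OF u] d' W _
            smooth_curve_has_velocity[OF \<gamma>_smooth c(1) u c(2)]]) simp
    then have "((coord ?d \<circ> \<beta>) has_vector_derivative ?D ?w) (at u)"
      by (rule has_vector_derivative_transform_within_open[OF _ domains_open(1) u]) (simp add: \<gamma>u)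
    then show ?thesis
      using smooth_curve_has_velocity[OF sc d(1) u d(2)] by (rule vector_derivative_unique_at)
  qed
  also have "gQ (\<beta> u) ?d (velocity \<beta> u ?d) (velocity \<beta> u ?d) = 1"
    using \<beta> u by (simp add: profile_curve_def norm_at_def inner_at_chart_at)
  finally show ?thesis .
qed

lemma metric_in_patch:
  assumes p: "patch c V" "x \<in> V"
  defines "q \<equiv> f (\<Psi> x)"
  shows "g q (cN q) (differential c (cN q) f (\<Psi> x) a) (differential c (cN q) f (\<Psi> x) b)
    = a $ 1 * b $ 1 + G (x $ 1) * (a $ 2 * b $ 2)"
proof -
  note pD = patchD[OF p]
  have u: "x $ 1 \<in> I" by (rule pD(4))
  define \<gamma>u where "\<gamma>u = \<gamma> (x $ 1)"
  note d = cN_chart[OF pD(11), folded q_def]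
  note c = cN_chart[OF \<gamma>_topspace[OF u], folded \<gamma>u_def]
  let ?D = "differential c (cN q) f (\<Psi> x)"
  let ?F = "differential (cN \<gamma>u) (cN q) (\<phi> (x $ 2)) \<gamma>u"
  let ?w = "velocity \<gamma> (x $ 1) (cN \<gamma>u)" and ?X = "X \<gamma>u (cN \<gamma>u)"
  have D: "?D (axis 1 1) = ?F ?w" "?D (axis 2 1) = ?F ?X"
    using differential_coordinate_vectors[OF p d(1)] d(2) by (simp_all add: q_def \<gamma>u_def)
  have F: "g q (cN q) (?F v) (?F w) = g \<gamma>u (cN \<gamma>u) v w" for v w
    using metric_differential_isometry[OF flow_smooth(2) c(1,2), of "x $ 2" v w] pD(10)
    by (simp add: q_def \<gamma>u_def)
  have "inner_at AN g \<gamma>u (velocity \<gamma> (x $ 1)) (X \<gamma>u) = 0"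
    using \<gamma> u by (simp add: horizontal_lift_def \<gamma>u_def)
  then have wX: "g \<gamma>u (cN \<gamma>u) ?w ?X = 0" by (simp add: inner_at_chart_at)
  then have Xw: "g \<gamma>u (cN \<gamma>u) ?X ?w = 0"
    using g c(1,2) unfolding riemannian_metric_def by metis
  have ww: "g \<gamma>u (cN \<gamma>u) ?w ?w = 1"
    using horizontal_lift_unit_speed[OF u] by (simp add: \<gamma>u_def)
  have XX: "g \<gamma>u (cN \<gamma>u) ?X ?X = G (x $ 1)"
    by (simp add: G_def inner_at_chart_at \<gamma>u_def)
  have lin: "linear ?D"
    using linear_differential[OF f_smooth pD(1) d(1) pD(6,7)] d(2) by (simp add: q_def)
  have ex: "?D z = z $ 1 *\<^sub>R ?F ?w + z $ 2 *\<^sub>R ?F ?X" for z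
    unfolding D[symmetric] linear_scale[OF lin, symmetric] linear_add[OF lin, symmetric]
    by (subst vec2_expand) (rule refl)
  have bl: "bilinear (g q (cN q))" using g d(1,2) by (simp add: riemannian_metric_def)
  show ?thesis
    unfolding ex
    by (simp add: bilinear_ladd[OF bl] bilinear_radd[OF bl] bilinear_lmul[OF bl] bilinear_rmul[OF bl]
        F wX Xw ww XX)
qed

lemma pullback_metric_in_patch:
  assumes "patch c V" "x \<in> V"
  shows "pullback_metric AN g f (\<Psi> x) c a b = a $ 1 * b $ 1 + G (x $ 1) * (a $ 2 * b $ 2)"
  unfolding pullback_metric_def inner_at_chart_at by (rule metric_in_patch[OF assms])

lemma G_C2:
  assumes "u \<in> I"
  shows "(G has_real_derivative deriv G u) (at u)"
    "(deriv G has_real_derivative deriv (deriv G) u) (at u)"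
proof -
  obtain W where "open W" "u \<in> W" "Ck_on 2 (\<lambda>u. inner_at AN g (\<gamma> u) (X (\<gamma> u)) (X (\<gamma> u))) W"
    by (rule Ck_on_norm_square_along_curve[OF N g X \<gamma>_smooth domains_open(1) assms])
  then have "open W" "u \<in> W" "Ck_on 2 G W" by (simp_all add: G_def[abs_def])
  then show "(G has_real_derivative deriv G u) (at u)"
    "(deriv G has_real_derivative deriv (deriv G) u) (at u)"
    by (simp_all add: Ck_on_2_real_deriv)
qed

lemma curvature_in_patch:
  assumes K: "constant_gauss_curvature AM (pullback_metric AN g f) K" and u: "u \<in> I"
  shows "- deriv (deriv G) u / (2 * G u) + (deriv G u / (2 * G u))\<^sup>2 = K"
proof -
  obtain v where v: "v \<in> J" using domains_open by blast
  obtain c V where p: "patch c V" "vector [u, v] \<in> V"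
    using patch_exists[of "vector [u, v]"] u v by auto
  let ?x = "vector [u, v] :: real^2"
  note pD = patchD[OF p]
  have "gauss_curvature (pullback_metric AN g f) c (\<Psi> ?x)
      = - deriv (deriv G) (coord c (\<Psi> ?x) $ 1) / (2 * G (coord c (\<Psi> ?x) $ 1))
        + (deriv G (coord c (\<Psi> ?x) $ 1) / (2 * G (coord c (\<Psi> ?x) $ 1)))\<^sup>2"
  proof (rule gauss_curvature_warped[where I = I, OF pD(3)])
    show "coord c (\<Psi> ?x) \<in> V" using p pD(8) by simp
    show "y $ 1 \<in> I" if "y \<in> V" for y by (rule patchD(4)[OF p(1) that])
    show "gram (pullback_metric AN g f) c y $ 1 $ 1 = 1 \<and> gram (pullback_metric AN g f) c y $ 1 $ 2 = 0
        \<and> gram (pullback_metric AN g f) c y $ 2 $ 1 = 0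
        \<and> gram (pullback_metric AN g f) c y $ 2 $ 2 = G (y $ 1)" if "y \<in> V" for y
      by (simp add: gram_def patchD(9)[OF p(1) that] pullback_metric_in_patch[OF p(1) that] axis_def)
  qed (use G_pos G_C2 in auto)
  moreover have "gauss_curvature (pullback_metric AN g f) c (\<Psi> ?x) = K"
    using K pD(1,6) unfolding constant_gauss_curvature_def by blast
  ultimately show ?thesis using pD(8) by simp
qed

lemma generator_norm:
  assumes p: "patch c V" "x \<in> V"
  shows "norm_at AN g (f (\<Psi> x)) (X (f (\<Psi> x))) = sqrt (G (x $ 1))"
  using metric_in_patch[OF p, of "axis 2 1" "axis 2 1"]
    differential_coordinate_vectors(2)[OF p cN_chart(1,2)[OF patchD(11)[OF p]]]
  by (simp add: norm_at_def inner_at_chart_at axis_def)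

lemma curve_in_patch:
  assumes \<alpha>: "smooth_curve TM AM L \<alpha>" and L: "open L" and \<kappa>: "continuous_on L \<kappa>"
    and \<alpha>\<kappa>: "\<And>s. s \<in> L \<Longrightarrow> \<kappa> s $ 1 \<in> I \<and> \<kappa> s $ 2 \<in> J \<and> \<alpha> s = \<Psi> (\<kappa> s)"
    and s: "s \<in> L"
  obtains w where "(\<kappa> has_vector_derivative w) (at s)"
    and "inner_at AM (pullback_metric AN g f) (\<alpha> s) (velocity \<alpha> s) (velocity \<alpha> s)
      = (w $ 1)\<^sup>2 + G (\<kappa> s $ 1) * (w $ 2)\<^sup>2"
    and "inner_at AN g (f (\<alpha> s)) (velocity (f \<circ> \<alpha>) s) (X (f (\<alpha> s))) = G (\<kappa> s $ 1) * w $ 2"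
    and "norm_at AN g (f (\<alpha> s)) (X (f (\<alpha> s))) = sqrt (G (\<kappa> s $ 1))"
proof -
  obtain c V where p: "patch c V" "\<kappa> s \<in> V" using patch_exists \<alpha>\<kappa>[OF s] by metis
  note pD = patchD[OF p]
  have \<alpha>s: "\<alpha> s = \<Psi> (\<kappa> s)" using \<alpha>\<kappa>[OF s] by blast
  define w where "w = velocity \<alpha> s c"
  define q where "q = f (\<alpha> s)"
  note d = cN_chart[OF pD(11), folded \<alpha>s, folded q_def]
  let ?W = "L \<inter> \<kappa> -` V"
  have W: "open ?W" "s \<in> ?W" using continuous_open_preimage[OF \<kappa> L pD(3)] s p by auto
  have "((coord c \<circ> \<alpha>) has_vector_derivative w) (at s)"
    unfolding w_def using smooth_curve_has_velocity[OF \<alpha> pD(1) s] pD(6) \<alpha>s by simp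
  then have \<kappa>w: "(\<kappa> has_vector_derivative w) (at s)"
    by (rule has_vector_derivative_transform_within_open[OF _ W])
      (use \<alpha>\<kappa> patchD(8)[OF p(1)] in auto)
  have vel: "velocity (f \<circ> \<alpha>) s (cN q) = differential c' (cN q) f (\<alpha> s) (velocity \<alpha> s c')"
    if c': "c' \<in> AM" "\<alpha> s \<in> dom_chart c'" for c'
  proof -
    have ch: "is_chart TM c'" by (rule smooth_manifold_is_chart[OF M c'(1)])
    have W': "open (L \<inter> \<alpha> -` dom_chart c')"
      using \<alpha> L ch by (intro open_preimage_of_curve) (auto simp: smooth_curve_def is_chart_def)
    have "((coord (cN q) \<circ> f \<circ> \<alpha>) has_vector_derivative
        differential c' (cN q) f (\<alpha> s) (velocity \<alpha> s c')) (at s)"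
      by (rule differential_along_curve[OF f_smooth c'(1) d(1) ch _ _ W' _ _
            smooth_curve_has_velocity[OF \<alpha> c'(1) s c'(2)]])
        (use d(2) s c' dom_chart_subset[OF ch] in \<open>auto simp: q_def\<close>)
    then show ?thesis by (simp add: velocity_def o_assoc vector_derivative_at)
  qed
  note velc = vel[OF pD(1), unfolded \<alpha>s, OF pD(6), folded \<alpha>s, folded w_def]
  have q: "q = f (\<Psi> (\<kappa> s))" by (simp add: q_def \<alpha>s)
  note metric = metric_in_patch[OF p, folded q, folded \<alpha>s]
  have "\<alpha> s \<in> topspace TM" using pD(7) \<alpha>s by simp
  note c' = chart_at[OF M this]
  have "inner_at AM (pullback_metric AN g f) (\<alpha> s) (velocity \<alpha> s) (velocity \<alpha> s)
      = g q (cN q) (velocity (f \<circ> \<alpha>) s (cN q)) (velocity (f \<circ> \<alpha>) s (cN q))"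
    unfolding vel[OF c'] by (simp add: inner_at_chart_at pullback_metric_def q_def)
  then have 1: "inner_at AM (pullback_metric AN g f) (\<alpha> s) (velocity \<alpha> s) (velocity \<alpha> s)
      = (w $ 1)\<^sup>2 + G (\<kappa> s $ 1) * (w $ 2)\<^sup>2"
    by (simp add: velc metric power2_eq_square)
  have "X q (cN q) = differential c (cN q) f (\<alpha> s) (axis 2 1)"
    using differential_coordinate_vectors(2)[OF p d(1)] d(2) by (simp add: q \<alpha>s)
  then have 2: "inner_at AN g (f (\<alpha> s)) (velocity (f \<circ> \<alpha>) s) (X (f (\<alpha> s))) = G (\<kappa> s $ 1) * w $ 2"
    by (simp add: inner_at_chart_at q_def[symmetric] velc metric axis_def)
  have 3: "norm_at AN g (f (\<alpha> s)) (X (f (\<alpha> s))) = sqrt (G (\<kappa> s $ 1))"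
    using generator_norm[OF p] by (simp add: \<alpha>s)
  show thesis by (rule that[OF \<kappa>w 1 2 3])
qed

end

theorem proposition6p1:
  fixes TN :: "'n topology" and AN :: "('n, 3) chart set" and g :: "('n, 3) metric"
    and X :: "'n \<Rightarrow> ('n, 3) tvec" and \<phi> :: "real \<Rightarrow> 'n \<Rightarrow> 'n"
    and Q :: "'n set topology" and AQ :: "('n set, 2) chart set" and gQ :: "('n set, 2) metric"
    and TM :: "'m topology" and AM :: "('m, 2) chart set" and f :: "'m \<Rightarrow> 'n"
    and R \<theta>\<^sub>0 :: real and I J L :: "real set"
    and \<beta> :: "real \<Rightarrow> 'n set" and \<gamma> :: "real \<Rightarrow> 'n" and \<omega> :: "real \<Rightarrow> real"
    and \<Psi> :: "real^2 \<Rightarrow> 'm" and \<alpha> :: "real \<Rightarrow> 'm" and \<kappa> :: "real \<Rightarrow> real^2"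
  assumes "smooth_manifold TN AN" and "riemannian_metric AN g"
    and "killing_field AN g X" and "one_parameter_isometries TN AN g \<phi>" and "flow_of TN AN X \<phi>"
    and "riemannian_orbit_space TN AN g \<phi> Q AQ gQ"
    and "invariant_surface TN AN \<phi> TM AM f"
    and "R \<noteq> 0" and "constant_gauss_curvature AM (pullback_metric AN g f) (1 / R\<^sup>2)"
    and "profile_curve Q AQ gQ I \<beta>" and "horizontal_lift TN AN g X \<phi> I \<beta> \<gamma>"
    and "open_interval J" and "local_parametrization AM {x. x $ 1 \<in> I \<and> x $ 2 \<in> J} \<Psi>"
    and "\<And>u v. u \<in> I \<Longrightarrow> v \<in> J \<Longrightarrow> f (\<Psi> (vector [u, v])) = \<phi> v (\<gamma> u)"
    and "\<And>u. \<omega> u = norm_at AN g (\<gamma> u) (X (\<gamma> u))"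
    and "loxodrome AN g X TM AM f \<theta>\<^sub>0 L \<alpha>" and "\<not> orbit_arc TN \<phi> f L \<alpha>"
    and "continuous_on L \<kappa>" and "\<And>s. s \<in> L \<Longrightarrow> \<kappa> s $ 1 \<in> I \<and> \<kappa> s $ 2 \<in> J \<and> \<alpha> s = \<Psi> (\<kappa> s)"
  shows "\<exists>\<sigma>\<in>{1, -1}. \<exists>a>0. \<exists>b. \<exists>I' v \<tau>.
           open_interval I' \<and> I' \<subseteq> I \<and> smooth_reparametrization I' L \<tau> \<and>
           (\<forall>u\<in>I'. v u = - \<sigma> * (R * cot \<theta>\<^sub>0 / sqrt a) * arsinh (R * (deriv \<omega> u / \<omega> u)) + b \<and>
              v u \<in> J \<and> \<alpha> (\<tau> u) = \<Psi> (vector [u, v u]))"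
proof -
  interpret invariant_patch TN AN g X \<phi> Q AQ gQ TM AM f I J \<beta> \<gamma> \<Psi>
    by unfold_locales (use assms(1-14) in \<open>auto simp: killing_field_def invariant_surface_def\<close>)
  note \<kappa> = assms(18,19)
  have \<omega>: "\<omega> = (\<lambda>u. sqrt (G u))" using assms(15) by (auto simp: norm_at_def G_def)
  have L: "open_interval L" "open L" "connected L" "L \<noteq> {}" and \<alpha>: "smooth_curve TM AM L \<alpha>"
    and \<theta>: "0 \<le> \<theta>\<^sub>0" "\<theta>\<^sub>0 < pi"
    using assms(16) by (auto simp: loxodrome_def open_interval_def is_interval_connected_1)
  have \<omega>_pos: "0 < \<omega> u" if "u \<in> I" for u using G_pos[OF that] by (simp add: \<omega>)
  have \<omega>_sq: "(\<omega> u)\<^sup>2 = G u" if "u \<in> I" for u using G_pos[OF that] by (simp add: \<omega>)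
  have \<omega>1: "(\<omega> has_real_derivative deriv \<omega> u) (at u)"
    and \<omega>2: "(deriv \<omega> has_real_derivative - \<omega> u / R\<^sup>2) (at u)" if "u \<in> I" for u
    using sqrt_of_curvature_equation[OF domains_open(1) that G_pos G_C2 curvature_in_patch[OF assms(9) that]]
    by (simp_all add: \<omega>)
  have "\<exists>w. (\<kappa> has_vector_derivative w) (at s) \<and> (w $ 1)\<^sup>2 + (\<omega> (\<kappa> s $ 1) * w $ 2)\<^sup>2 = 1 \<and>
      \<omega> (\<kappa> s $ 1) * w $ 2 = cos \<theta>\<^sub>0" if s: "s \<in> L" for s
  proof -
    obtain w where w: "(\<kappa> has_vector_derivative w) (at s)"
      "inner_at AM (pullback_metric AN g f) (\<alpha> s) (velocity \<alpha> s) (velocity \<alpha> s)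
        = (w $ 1)\<^sup>2 + G (\<kappa> s $ 1) * (w $ 2)\<^sup>2"
      "inner_at AN g (f (\<alpha> s)) (velocity (f \<circ> \<alpha>) s) (X (f (\<alpha> s))) = G (\<kappa> s $ 1) * w $ 2"
      "norm_at AN g (f (\<alpha> s)) (X (f (\<alpha> s))) = sqrt (G (\<kappa> s $ 1))"
      by (rule curve_in_patch[OF \<alpha> L(2) \<kappa> s])
    have u: "\<kappa> s $ 1 \<in> I" using \<kappa> s by blast
    have "norm_at AM (pullback_metric AN g f) (\<alpha> s) (velocity \<alpha> s) = 1"
      and ang: "inner_at AN g (f (\<alpha> s)) (velocity (f \<circ> \<alpha>) s) (X (f (\<alpha> s)))
          = norm_at AN g (f (\<alpha> s)) (X (f (\<alpha> s))) * cos \<theta>\<^sub>0"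
      using assms(16) s by (auto simp: loxodrome_def)
    then have "(w $ 1)\<^sup>2 + G (\<kappa> s $ 1) * (w $ 2)\<^sup>2 = 1" by (simp add: norm_at_def w(2))
    moreover have "G (\<kappa> s $ 1) * w $ 2 = \<omega> (\<kappa> s $ 1) * cos \<theta>\<^sub>0"
      using ang by (simp add: w(3,4) \<omega>)
    then have "\<omega> (\<kappa> s $ 1) * (\<omega> (\<kappa> s $ 1) * w $ 2) = \<omega> (\<kappa> s $ 1) * cos \<theta>\<^sub>0"
      unfolding \<omega>_sq[OF u, symmetric] by (simp only: power2_eq_square mult.assoc)
    ultimately show ?thesis
      using w(1) \<omega>_pos[OF u] \<omega>_sq[OF u] by (auto simp: power_mult_distrib)
  qed
  then obtain w where w: "\<And>s. s \<in> L \<Longrightarrow> (\<kappa> has_vector_derivative w s) (at s)"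
    and arc: "\<And>s. s \<in> L \<Longrightarrow> (w s $ 1)\<^sup>2 + (\<omega> (\<kappa> s $ 1) * w s $ 2)\<^sup>2 = 1"
    and angle: "\<And>s. s \<in> L \<Longrightarrow> \<omega> (\<kappa> s $ 1) * w s $ 2 = cos \<theta>\<^sub>0"
    by metis
  have \<kappa>_der: "((\<lambda>s. \<kappa> s $ i) has_real_derivative w s $ i) (at s)" if "s \<in> L" for s i
    using bounded_linear.has_vector_derivative[OF bounded_linear_vec_nth w[OF that]]
    by (simp add: has_real_derivative_iff_has_vector_derivative)
  have "\<theta>\<^sub>0 \<noteq> 0"
  proof
    assume "\<theta>\<^sub>0 = 0"
    then have "w s $ 1 = 0" if "s \<in> L" for s using arc[OF that] angle[OF that] by simp
    then have "((\<lambda>s. \<kappa> s $ 1) has_real_derivative 0) (at s)" if "s \<in> L" for s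
      using \<kappa>_der[OF that, of 1] that by simp
    then obtain e where e: "\<And>s. s \<in> L \<Longrightarrow> \<kappa> s $ 1 = e"
      using DERIV_zero_constant_on_open[OF L(2,3)] by blast
    have "e \<in> I" using e \<kappa>(2) L(4) by (metis ex_in_conv)
    have "f (\<alpha> s) = \<phi> (\<kappa> s $ 2) (\<gamma> e)" if "s \<in> L" for s
      using \<kappa>(2)[OF that] f\<Psi>[of e "\<kappa> s $ 2"] e[OF that] vector_2_eq[of "\<kappa> s"] by simp
    then have "f ` \<alpha> ` L \<subseteq> orbit_GX TN \<phi> (\<gamma> e)" by (auto simp: orbit_GX_eq)
    then have "orbit_arc TN \<phi> f L \<alpha>"
      using \<gamma>_topspace[OF \<open>e \<in> I\<close>] unfolding orbit_arc_def by blast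
    with assms(17) show False ..
  qed
  then have "0 < sin \<theta>\<^sub>0" using \<theta> by (intro sin_gt_zero) auto
  from loxodrome_in_warped_product[OF domains_open(4) L(1) \<open>R \<noteq> 0\<close> \<omega>_pos \<omega>1 \<omega>2 _ \<kappa>_der \<kappa>_der arc angle this]
  obtain \<sigma> a b I' \<tau> where \<sigma>: "\<sigma> \<in> {1, -1}" and "0 < a" and I': "open_interval I'" "I' \<subseteq> I"
    and \<tau>: "smooth_reparametrization I' L \<tau>"
    and sol: "\<And>u. u \<in> I' \<Longrightarrow> \<kappa> (\<tau> u) $ 1 = u \<and>
      \<kappa> (\<tau> u) $ 2 = - \<sigma> * (R * cot \<theta>\<^sub>0 / sqrt a) * arsinh (R * (deriv \<omega> u / \<omega> u)) + b"
    using \<kappa>(2) by metis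
  have "\<tau> u \<in> L" if "u \<in> I'" for u
    using \<tau> that by (auto simp: smooth_reparametrization_def dest: bij_betwE)
  then have "\<kappa> (\<tau> u) $ 2 \<in> J \<and> \<alpha> (\<tau> u) = \<Psi> (vector [u, \<kappa> (\<tau> u) $ 2])" if "u \<in> I'" for u
    using \<kappa>(2)[of "\<tau> u"] that sol[OF that] vector_2_eq[of "\<kappa> (\<tau> u)"] by metis
  then show ?thesis
    using \<sigma> \<open>0 < a\<close> I' \<tau> sol
    by (intro bexI[of _ \<sigma>] exI[of _ a] conjI exI[of _ b] exI[of _ I'] exI[of _ "\<lambda>u. \<kappa> (\<tau> u) $ 2"]
        exI[of _ \<tau>]) auto
qed

end
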